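(* Let $\kappa>0$ and let $(X,d)$ be a locally compact, uniquely geodesic $\mathrm{CAT}(\kappa)$ space with diameter smaller than $\frac{\pi}{2\sqrt{\kappa}}$, such that for every $p\in X$ the space $X$ has the geodesic extension property around $p$ with a constant $R_p<\frac{\pi}{2\sqrt{\kappa}}$. Let $f,g : X\to(-\infty,\infty]$ be two convex functions that have complete sublevel sets. If $x\in\operatorname{dom} f\cap\operatorname{dom} g$ is a minimum point of $f+g$ and $f$ is continuous at $x$, then there exist $([\gamma],r)\in\partial f(x)$ and $([\eta],s)\in\partial g(x)$ such that $([\gamma],r)$ and $([\eta],s)$ are opposite to each other.
   Context: Geodesics. A geodesic is an isometric map $\gamma:[0,l]\to X$; it issues at $\gamma(0)$. $X$ is uniquely geodesic if every two points are joined by a unique geodesic segment. $C\subseteq X$ is convex if it contains every geodesic segment joining two of its points. $X$ has the geodesic extension property around $p\in X$ with constant $R>0$ if for any distinct $y,z\in B(p,R)$ with $d(y,z)<R$, the geodesic from $y$ to $z$ can be extended beyond $z$ to a geodesic of length $R$. A $\mathrm{CAT}(\kappa)$ space ($\kappa>0$) is a metric space in which points at distance less than $\pi/\sqrt\kappa$ are joined by a geodesic and geodesic triangles of perimeter less than $2\pi/\sqrt\kappa$ are not thicker than their comparison triangles in the simply connected surface of constant curvature $\kappa$. Tangent space. For $x\in X$, $\Sigma_xX$ is the set of equivalence classes $[\gamma]$ of nonconstant geodesics issuing at $x$, where $\gamma\sim\eta$ iff the Alexandrov angle $\angle(\gamma,\eta)$ is $0$. By geodesic extension, a representative may always be taken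 of length at least $R_x$. The tangent space $T_xX$ is the Euclidean cone over $(\Sigma_xX,\angle)$: its elements are pairs $([\gamma],r)$ with $[\gamma]\in\Sigma_xX$, $r\ge0$, all pairs with $r=0$ being identified to one point $o_x$, the origin (for $o_x$ the geodesic may also be taken constantly equal to $x$). Elements $([\gamma],r),([\eta],s)\in T_xX$ are opposite to each other if $r=s=0$, or $r=s>0$ and $\angle(\gamma,\eta)=\pi$. Normal cone. For a uniquely geodesic space $Y$ of this kind, $C\subseteq Y$ nonempty convex and $y\in C$, let $P_C(z)=\{c\in C: d(z,c)=\operatorname{dist}(z,C)\}$ and $N_C(y)=\{([\gamma],r)\in T_yY : r=0 \text{ or } P_C(\gamma(t))=\{y\}\text{ for some }t>0\}$. Functions. $f:X\to(-\infty,\infty]$ is convex if $f(\gamma(lt))\le(1-t)f(\gamma(0))+tf(\gamma(l))$ for every geodesic $\gamma:[0,l]\to X$ and $t\in[0,1]$; $\operatorname{dom} f=\{f<\infty\}$; $\operatorname{epi} f=\{(x,\lambda)\in\operatorname{dom} f\times\mathbb{R}:\lambda\ge f(x)\}$. "Complete sublevel sets" means that each set $\{y\in X: f(y)\le a\}$, $a\in\mathbb{R}$, is complete in the induced metric. Subdifferential. $X\times\mathbb{R}$ carries the metric $d_2((x_1,y_1),(x_2,y_2))=\sqrt{d(x_1,x_2)^2+|y_1-y_2|^2}$. For $f$ convex and $x\in\operatorname{dom} f$, $([\gamma],r)\in T_xX$ is a subgradient of $f$ at $x$ if $([\sigma],1)\in N_{\operatorname{epi} f}(x,f(x))$ (normal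 cone in $X\times\mathbb{R}$), where $\sigma:[0,R_x]\to X\times\mathbb{R}$, $\sigma(t)=\left(\gamma\left(rt/\sqrt{r^2+1}\right),\,f(x)-t/\sqrt{r^2+1}\right)$. The set of subgradients is $\partial f(x)$. *)

theory Defs
  imports "HOL-Analysis.Analysis"
begin

section \<open>Geodesics\<close>

definition geodesic :: "real \<Rightarrow> (real \<Rightarrow> 'a::metric_space) \<Rightarrow> bool" where
  "geodesic l \<gamma> \<longleftrightarrow> 0 \<le> l \<and> (\<forall>s\<in>{0..l}. \<forall>t\<in>{0..l}. dist (\<gamma> s) (\<gamma> t) = \<bar>s - t\<bar>)"

definition geodesic_segment :: "'a::metric_space \<Rightarrow> 'a \<Rightarrow> 'a set \<Rightarrow> bool" where
  "geodesic_segment y z S \<longleftrightarrow> (\<exists>l \<gamma>. geodesic l \<gamma> \<and> \<gamma> 0 = y \<and> \<gamma> l = z \<and> S = \<gamma> ` {0..l})"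

definition uniquely_geodesic :: "'a::metric_space itself \<Rightarrow> bool" where
  "uniquely_geodesic _ \<longleftrightarrow> (\<forall>y z :: 'a. \<exists>!S. geodesic_segment y z S)"

definition geodesic_extension_around :: "'a::metric_space \<Rightarrow> real \<Rightarrow> bool" where
  "geodesic_extension_around p R \<longleftrightarrow> 0 < R \<and>
     (\<forall>y\<in>ball p R. \<forall>z\<in>ball p R. y \<noteq> z \<and> dist y z < R \<longrightarrow>
        (\<forall>l \<gamma>. geodesic l \<gamma> \<and> \<gamma> 0 = y \<and> \<gamma> l = z \<longrightarrow>
           (\<exists>\<gamma>'. geodesic R \<gamma>' \<and> (\<forall>t\<in>{0..l}. \<gamma>' t = \<gamma> t))))"


section \<open>CAT(\<open>\<kappa>\<close>) spaces for positive \<open>\<kappa>\<close>\<close>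

text \<open>The model surface of constant curvature \<open>\<kappa>\<close> is the sphere of radius \<open>1 / sqrt \<kappa>\<close>
  in Euclidean 3-space with its angular (great circle) metric.\<close>

definition model_surface :: "real \<Rightarrow> (real ^ 3) set" where
  "model_surface \<kappa> = sphere 0 (1 / sqrt \<kappa>)"

definition model_dist :: "real \<Rightarrow> real ^ 3 \<Rightarrow> real ^ 3 \<Rightarrow> real" where
  "model_dist \<kappa> u v = arccos (\<kappa> * (u \<bullet> v)) / sqrt \<kappa>"

text \<open>The vertices and the sides of a triangle are indexed by the cyclic type \<open>3\<close>, the side
  with index \<open>i\<close> joining the vertices with indices \<open>i\<close> and \<open>i + 1\<close>.\<close>

definition geodesic_triangle :: "(3 \<Rightarrow> 'a::metric_space) \<Rightarrow> (3 \<Rightarrow> 'a set) \<Rightarrow> bool" where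
  "geodesic_triangle v S \<longleftrightarrow> (\<forall>i. geodesic_segment (v i) (v (i + 1)) (S i))"

definition perimeter :: "(3 \<Rightarrow> 'a::metric_space) \<Rightarrow> real" where
  "perimeter v = (\<Sum>i\<in>UNIV. dist (v i) (v (i + 1)))"

definition comparison_triangle ::
    "real \<Rightarrow> (3 \<Rightarrow> 'a::metric_space) \<Rightarrow> (3 \<Rightarrow> real ^ 3) \<Rightarrow> bool" where
  "comparison_triangle \<kappa> v w \<longleftrightarrow>
     (\<forall>i. w i \<in> model_surface \<kappa> \<and> model_dist \<kappa> (w i) (w (i + 1)) = dist (v i) (v (i + 1)))"

definition comparison_point ::
    "real \<Rightarrow> (3 \<Rightarrow> 'a::metric_space) \<Rightarrow> (3 \<Rightarrow> real ^ 3) \<Rightarrow> 3 \<Rightarrow> 'a \<Rightarrow> real ^ 3 \<Rightarrow> bool" where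
  "comparison_point \<kappa> v w i p p' \<longleftrightarrow> p' \<in> model_surface \<kappa> \<and>
     model_dist \<kappa> (w i) p' = dist (v i) p \<and>
     model_dist \<kappa> p' (w (i + 1)) = dist p (v (i + 1))"

text \<open>Comparison triangles of triangles of perimeter less than \<open>2 * pi / sqrt \<kappa>\<close> exist and are
  unique up to isometry, so it does not matter that they are quantified universally below.\<close>

definition CAT :: "real \<Rightarrow> 'a::metric_space itself \<Rightarrow> bool" where
  "CAT \<kappa> _ \<longleftrightarrow>
     (\<forall>y z :: 'a. dist y z < pi / sqrt \<kappa> \<longrightarrow> (\<exists>S. geodesic_segment y z S)) \<and>
     (\<forall>(v :: 3 \<Rightarrow> 'a) S. geodesic_triangle v S \<and> perimeter v < 2 * pi / sqrt \<kappa> \<longrightarrow>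
        (\<forall>w i j p q p' q'. comparison_triangle \<kappa> v w \<and>
           p \<in> S i \<and> comparison_point \<kappa> v w i p p' \<and>
           q \<in> S j \<and> comparison_point \<kappa> v w j q q' \<longrightarrow>
           dist p q \<le> model_dist \<kappa> p' q'))"


section \<open>Tangent space\<close>

text \<open>The Alexandrov angle of two geodesics with a common starting point is the upper limit, as
  \<open>s, t\<close> tend to 0 from the right independently, of the Euclidean comparison angles; these
  are real numbers between 0 and \<open>pi\<close>.\<close>

definition comparison_angle ::
    "(real \<Rightarrow> 'a::metric_space) \<Rightarrow> (real \<Rightarrow> 'a) \<Rightarrow> real \<Rightarrow> real \<Rightarrow> real" where
  "comparison_angle \<gamma> \<eta> s t = arccos ((s\<^sup>2 + t\<^sup>2 - (dist (\<gamma> s) (\<eta> t))\<^sup>2) / (2 * s * t))"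

definition alexandrov_angle :: "(real \<Rightarrow> 'a::metric_space) \<Rightarrow> (real \<Rightarrow> 'a) \<Rightarrow> real" where
  "alexandrov_angle \<gamma> \<eta> = real_of_ereal
     (Limsup (at_right 0 \<times>\<^sub>F at_right 0) (\<lambda>(s, t). ereal (comparison_angle \<gamma> \<eta> s t)))"

text \<open>A geodesic \<open>\<gamma>\<close> on \<open>{0..l}\<close> is recorded as the pair \<open>(l, \<gamma>)\<close>; the values of \<open>\<gamma>\<close> outside
  of \<open>{0..l}\<close> are irrelevant. In particular the angle above only depends on the values near 0.\<close>

definition geodesics_from :: "'a::metric_space \<Rightarrow> (real \<times> (real \<Rightarrow> 'a)) set" where
  "geodesics_from x = {(l, \<gamma>). 0 < l \<and> geodesic l \<gamma> \<and> \<gamma> 0 = x}"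

definition same_direction ::
    "'a::metric_space \<Rightarrow> ((real \<times> (real \<Rightarrow> 'a)) \<times> (real \<times> (real \<Rightarrow> 'a))) set" where
  "same_direction x = {((l, \<gamma>), (m, \<eta>)). (l, \<gamma>) \<in> geodesics_from x \<and> (m, \<eta>) \<in> geodesics_from x \<and>
     alexandrov_angle \<gamma> \<eta> = 0}"

type_synonym 'a direction = "(real \<times> (real \<Rightarrow> 'a)) set"

definition directions :: "'a::metric_space \<Rightarrow> 'a direction set" where
  "directions x = geodesics_from x // same_direction x"

text \<open>The origin, to which all pairs \<open>(\<xi>, 0)\<close> are identified, belongs to the cone even if there are
  no directions (that is, if the space is a single point).\<close>

datatype 'b cone = Origin | Ray 'b real

definition cone_point :: "'b \<Rightarrow> real \<Rightarrow> 'b cone" where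
  "cone_point \<xi> r = (if r = 0 then Origin else Ray \<xi> r)"

definition tangent_space :: "'a::metric_space \<Rightarrow> 'a direction cone set" where
  "tangent_space x = insert Origin {cone_point \<xi> r | \<xi> r. \<xi> \<in> directions x \<and> 0 \<le> r}"

text \<open>The element \<open>([\<gamma>], r)\<close> of the tangent space at \<open>x\<close>. For \<open>r = 0\<close> this is the origin, whatever
  \<open>\<gamma>\<close> is; so \<open>\<gamma>\<close> may be constant in this case.\<close>

definition tangent_vector :: "'a::metric_space \<Rightarrow> real \<Rightarrow> (real \<Rightarrow> 'a) \<Rightarrow> real \<Rightarrow> 'a direction cone" where
  "tangent_vector x l \<gamma> r = cone_point (same_direction x `` {(l, \<gamma>)}) r"

definition opposite :: "'a::metric_space direction cone \<Rightarrow> 'a direction cone \<Rightarrow> bool" where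
  "opposite u v \<longleftrightarrow> (u = Origin \<and> v = Origin) \<or>
     (\<exists>\<xi> \<zeta> r. u = Ray \<xi> r \<and> v = Ray \<zeta> r \<and> 0 < r \<and>
        (\<exists>(l, \<gamma>)\<in>\<xi>. \<exists>(m, \<eta>)\<in>\<zeta>. alexandrov_angle \<gamma> \<eta> = pi))"


section \<open>Normal cone\<close>

definition metric_proj :: "'a::metric_space set \<Rightarrow> 'a \<Rightarrow> 'a set" where
  "metric_proj C z = {c\<in>C. dist z c = infdist z C}"

definition normal_cone :: "'a::metric_space set \<Rightarrow> 'a \<Rightarrow> 'a direction cone set" where
  "normal_cone C y = {v \<in> tangent_space y. v = Origin \<or>
     (\<exists>l \<gamma> r. (l, \<gamma>) \<in> geodesics_from y \<and> v = tangent_vector y l \<gamma> r \<and>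
        (\<exists>t. 0 < t \<and> t \<le> l \<and> metric_proj C (\<gamma> t) = {y}))}"


section \<open>Convex functions and the subdifferential\<close>

text \<open>In \<^typ>\<open>ereal\<close> we have \<open>0 * \<infinity> = 0\<close>, so the inequality below is trivially true for
  \<open>t = 0\<close> and \<open>t = 1\<close>.\<close>

definition geodesically_convex :: "('a::metric_space \<Rightarrow> ereal) \<Rightarrow> bool" where
  "geodesically_convex f \<longleftrightarrow> (\<forall>l \<gamma>. geodesic l \<gamma> \<longrightarrow>
     (\<forall>t\<in>{0..1}. f (\<gamma> (l * t)) \<le> ereal (1 - t) * f (\<gamma> 0) + ereal t * f (\<gamma> l)))"

definition eff_dom :: "('a \<Rightarrow> ereal) \<Rightarrow> 'a set" where
  "eff_dom f = {y. f y < \<infinity>}"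

definition epi :: "('a \<Rightarrow> ereal) \<Rightarrow> ('a \<times> real) set" where
  "epi f = {(y, a). y \<in> eff_dom f \<and> f y \<le> ereal a}"

definition complete_sublevel_sets :: "('a::metric_space \<Rightarrow> ereal) \<Rightarrow> bool" where
  "complete_sublevel_sets f \<longleftrightarrow> (\<forall>a::real. complete {y. f y \<le> ereal a})"

definition graph_geodesic ::
    "('a \<Rightarrow> ereal) \<Rightarrow> 'a \<Rightarrow> (real \<Rightarrow> 'a) \<Rightarrow> real \<Rightarrow> real \<Rightarrow> 'a \<times> real" where
  "graph_geodesic f x \<gamma> r t =
     (\<gamma> (r * t / sqrt (r\<^sup>2 + 1)), real_of_ereal (f x) - t / sqrt (r\<^sup>2 + 1))"

text \<open>\<open>R\<close> is the constant of geodesic extension around \<open>x\<close>. The distance on the product type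
  \<^typ>\<open>'a \<times> real\<close> is the \<open>\<ell>\<^sup>2\<close> product distance. The second alternative for \<open>\<gamma>\<close>
  only matters if there are no nonconstant geodesics issuing at \<open>x\<close>.\<close>

definition subdifferential ::
    "real \<Rightarrow> ('a::metric_space \<Rightarrow> ereal) \<Rightarrow> 'a \<Rightarrow> 'a direction cone set" where
  "subdifferential R f x = {v \<in> tangent_space x. \<exists>l \<gamma> r. 0 \<le> r \<and>
     ((l, \<gamma>) \<in> geodesics_from x \<and> R \<le> l \<or> r = 0 \<and> \<gamma> = (\<lambda>_. x)) \<and>
     v = tangent_vector x l \<gamma> r \<and>
     tangent_vector (x, real_of_ereal (f x)) R (graph_geodesic f x \<gamma> r) 1
       \<in> normal_cone (epi f) (x, real_of_ereal (f x))}"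

end

theory Submission
  imports Defs
begin

text \<open>Let \<open>m = f x + g x\<close>. In \<open>X \<times> \<real>\<close> the epigraph of \<open>f\<close> and the hypograph of
  \<open>m - g\<close> touch at \<open>(x, f x)\<close>. Adding to \<open>f\<close> a small convex function that vanishes only at \<open>x\<close> and a
  small constant separates the two sets, with nearest pairs \<open>c, d\<close> close to \<open>(x, f x)\<close>. Extend the
  geodesic between \<open>d\<close> and \<open>c\<close> on both sides to the fixed length \<open>\<delta>\<close>. By the CAT inequality the first
  variation of the squared distance is linear along geodesics, so the point beyond \<open>c\<close> still projects to
  \<open>d\<close> and the one beyond \<open>d\<close> to \<open>c\<close>. By local compactness these points converge to points \<open>p, q\<close> at
  distance \<open>\<delta>\<close> in opposite normal directions at \<open>(x, f x)\<close>. The continuity of \<open>f\<close> makes these directions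
  non-horizontal, and their horizontal parts are the opposite subgradients.\<close>

section \<open>Spherical trigonometry\<close>

text \<open>Where the two sets touch, no segment realises a distance between them, so no normal
  direction is visible at the contact point itself. Nearest pairs of the separated sets have one,
  but their segments shrink to a point. Prolonging them to length \<open>\<delta>\<close> replaces
  directions by points, and everything needed of these points is a closed condition: distance at
  least \<open>\<delta>\<close> to the convex set, and
  \<open>dist p q = 2 * \<delta> * \<alpha>\<close>, which makes \<open>x\<close> a midpoint of the
  horizontal parts and the angle \<open>pi\<close>. Passing to the limit may cost the uniqueness of
  the projection; the strict form of the spherical cosine rule restores it. A direction in the
  product is recorded by its horizontal and vertical components \<open>\<alpha>\<close> and
  \<open>\<beta>\<close> with \<open>\<alpha>\<^sup>2 + \<beta>\<^sup>2 = 1\<close>; a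
  non-horizontal one becomes a subgradient of length \<open>\<alpha> / \<beta>\<close>.\<close>

lemma sin_concave_scale:
  assumes "0 \<le> t" "t \<le> 1" "0 \<le> x" "x \<le> pi"
  shows "t * sin x \<le> sin (t * x)"
proof -
  have "convex_on {0..pi} (\<lambda>x. - sin x)"
    by (rule f''_ge0_imp_convex[where f' = "\<lambda>x. - cos x" and f'' = sin])
       (auto intro!: derivative_eq_intros sin_ge_zero)
  from convex_onD[OF this assms(1,2), of 0 x] assms(3,4) show ?thesis by simp
qed

text \<open>As a function of \<open>cos y\<close>, half the square of \<open>y\<close> is convex
  with slope \<open>- x / sin x\<close> at \<open>y = x\<close>; the left side is the tangent line
  there. The sign of the derivative in \<open>y\<close> comes from \<open>sin z / z\<close> being
  decreasing.\<close>

lemma half_square_ge_cos_tangent: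
  assumes "0 < x" "x \<le> pi/2" "0 \<le> y" "y \<le> pi"
  shows "x\<^sup>2 / 2 - x / sin x * (cos y - cos x) \<le> y\<^sup>2 / 2"
proof -
  have sx: "0 < sin x" using assms pi_gt_zero by (intro sin_gt_zero) linarith+
  define F where "F y = y\<^sup>2 / 2 + x / sin x * (cos y - cos x)" for y
  have der: "(F has_real_derivative (y - x / sin x * sin y)) (at y)" for y
    unfolding F_def using sx by (auto intro!: derivative_eq_intros)
  have "F x \<le> F y"
  proof (cases "x \<le> y")
    case True
    have "0 \<le> z - x / sin x * sin z" if "x \<le> z" "z \<le> y" for z
      using sin_concave_scale[of "x/z" z] that assms sx
      by (simp add: pos_divide_le_eq mult.commute)
    with der show ?thesis by (intro DERIV_nonneg_imp_nondecreasing[OF True]) blast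
  next
    case False
    have "z - x / sin x * sin z \<le> 0" if "y \<le> z" "z \<le> x" for z
      using sin_concave_scale[of "z/x" x] that assms sx
      by (simp add: field_simps)
    with der show ?thesis using False
      by (intro DERIV_nonpos_imp_nonincreasing[of y x]) (simp, blast)
  qed
  then show ?thesis by (simp add: F_def)
qed

text \<open>The difference of the derivatives is \<open>sin z + cos z - 1\<close>, positive because
  the square of \<open>sin z + cos z\<close> exceeds 1 inside the first quadrant. In the cosine rule
  the quadratic gain \<open>1 - cos M\<close> thus absorbs the cubic error
  \<open>M - sin M\<close>.\<close>

lemma diff_sin_less_one_minus_cos:
  assumes "0 < x" "x < pi/2"
  shows "x - sin x < 1 - cos x"
proof -
  have "(\<lambda>x. 1 - cos x - x + sin x) 0 < (\<lambda>x. 1 - cos x - x + sin x) x"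
  proof (rule DERIV_pos_imp_increasing_open[OF assms(1)])
    fix z assume z: "0 < z" "z < x"
    then have "0 < sin z" "0 < cos z" using assms by (auto intro!: sin_gt_zero2 cos_gt_zero)
    then have "1 < (sin z + cos z)\<^sup>2"
      using sin_cos_squared_add[of z] by (simp add: power2_sum)
    then have "1 < sin z + cos z"
      using \<open>0 < sin z\<close> \<open>0 < cos z\<close> power2_less_imp_less[of 1 "sin z + cos z"] by simp
    then show "\<exists>y. ((\<lambda>x. 1 - cos x - x + sin x) has_real_derivative y) (at z) \<and> 0 < y"
      by (intro exI[of _ "sin z - 1 + cos z"]) (auto intro!: derivative_eq_intros)
  qed (auto intro!: continuous_intros)
  then show ?thesis by simp
qed

text \<open>On the sphere, half the squared distance to a point lies strictly above its tangents along
  geodesics; the quarter circle bound on \<open>L\<close> is what makes the two remainders comparable.\<close>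

lemma spherical_cosine_rule_strict:
  assumes "0 < L" "L \<le> pi/4" "0 < M" "M < pi/2" "0 \<le> D" "D \<le> pi" "\<bar>Q\<bar> \<le> 1"
    and "cos D = cos L * cos M + sin L * sin M * Q"
  shows "L\<^sup>2 - 2 * L * M * Q < D\<^sup>2"
proof -
  have L: "0 < sin L" "0 < cos L" "sin L \<le> cos L"
    using assms by (auto intro!: sin_gt_zero2 cos_gt_zero simp: sin_cos_eq)
      (simp add: cos_mono_le_eq)
  have pos: "0 < 1 - cos M" "sin M \<le> M"
    using assms cos_monotone_0_pi[of 0 M] by (auto simp: sin_x_le_x)
  \<comment> \<open>The gap \<open>sin L * M * Q - (cos D - cos L)\<close> equals
    \<open>cos L * (1 - cos M) + sin L * (M - sin M) * Q\<close>, so only a negative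
    \<open>Q\<close> can hurt, and \<open>Q = - 1\<close> is the worst case.\<close>
  have "sin L * ((M - sin M) * (- Q)) \<le> sin L * (M - sin M)"
    using L pos assms(7) mult_left_le[of "- Q" "M - sin M"] by (intro mult_left_mono) auto
  also have "\<dots> < sin L * (1 - cos M)"
    using L diff_sin_less_one_minus_cos[OF assms(3,4)] by simp
  also have "\<dots> \<le> cos L * (1 - cos M)" using L pos by (intro mult_right_mono) auto
  finally have "sin L * (M - sin M) * (- Q) < cos L * (1 - cos M)" by simp
  then have "cos D - cos L < sin L * M * Q"
    using assms(8) by (simp add: algebra_simps)
  then have "L / sin L * (cos D - cos L) < L / sin L * (sin L * M * Q)"
    using L assms(1) by (intro mult_strict_left_mono) auto
  then have "L / sin L * (cos D - cos L) < L * M * Q" using L by simp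
  moreover have "L \<le> pi/2" using assms(1,2) by simp
  ultimately show ?thesis using half_square_ge_cos_tangent[OF assms(1) _ assms(5,6)] by simp
qed

section \<open>Geodesics and the hinge inequality\<close>

text \<open>Parametrisation proportional to arc length on the unit interval, constant curves
  included: one parameter then serves both coordinates of a segment in the product, even a vertical
  one.\<close>

definition affine_geodesic :: "(real \<Rightarrow> 'a::metric_space) \<Rightarrow> bool" where
  "affine_geodesic c \<longleftrightarrow> (\<exists>l. \<forall>s\<in>{0..1}. \<forall>t\<in>{0..1}. dist (c s) (c t) = l * \<bar>s - t\<bar>)"

lemma affine_geodesicI:
  "(\<And>s t. 0 \<le> s \<Longrightarrow> s \<le> 1 \<Longrightarrow> 0 \<le> t \<Longrightarrow> t \<le> 1 \<Longrightarrow> dist (c s) (c t) = l * \<bar>s - t\<bar>) \<Longrightarrow> affine_geodesic c"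
  by (auto simp: affine_geodesic_def)

lemma affine_geodesicD:
  assumes "affine_geodesic c" "0 \<le> s" "s \<le> 1" "0 \<le> t" "t \<le> 1"
  shows "dist (c s) (c t) = dist (c 0) (c 1) * \<bar>s - t\<bar>"
  using assms by (auto simp: affine_geodesic_def)

lemma geodesic_dist_ends: "geodesic l \<gamma> \<Longrightarrow> dist (\<gamma> 0) (\<gamma> l) = l"
  by (auto simp: geodesic_def)

lemma affine_geodesic_rescale:
  assumes "geodesic l \<gamma>"
  shows "affine_geodesic (\<lambda>t. \<gamma> (l * t))"
proof (rule affine_geodesicI)
  fix s t :: real
  assume "0 \<le> s" "s \<le> 1" "0 \<le> t" "t \<le> 1"
  then have "l * s \<in> {0..l}" "l * t \<in> {0..l}" "0 \<le> l"
    using assms by (auto simp: geodesic_def mult_left_le)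
  with assms show "dist (\<gamma> (l * s)) (\<gamma> (l * t)) = l * \<bar>s - t\<bar>"
    by (simp add: geodesic_def abs_mult flip: right_diff_distrib)
qed

lemma affine_geodesic_unit_speed:
  assumes "affine_geodesic c"
  shows "\<exists>\<gamma>. geodesic (dist (c 0) (c 1)) \<gamma> \<and> (\<forall>t\<in>{0..1}. \<gamma> (dist (c 0) (c 1) * t) = c t)"
proof (cases "c 0 = c 1")
  case True
  have "c 0 = c t" if "t \<in> {0..1}" for t
    using affine_geodesicD[OF assms, of t 0] True that by simp
  with True[symmetric] show ?thesis by (intro exI[of _ "\<lambda>_. c 0"]) (simp add: geodesic_def)
next
  case False
  define l where "l = dist (c 0) (c 1)"
  have l: "0 < l" using False by (simp add: l_def)
  have "geodesic l (\<lambda>t. c (t / l))"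
    unfolding geodesic_def
  proof (intro conjI ballI)
    fix s t assume "s \<in> {0..l}" "t \<in> {0..l}"
    then have "dist (c (s / l)) (c (t / l)) = l * \<bar>s / l - t / l\<bar>"
      using l unfolding l_def by (intro affine_geodesicD[OF assms]) auto
    also have "\<dots> = \<bar>s - t\<bar>" using l by (simp add: abs_mult_pos flip: diff_divide_distrib)
    finally show "dist (c (s / l)) (c (t / l)) = \<bar>s - t\<bar>" .
  qed (use l in simp)
  then show ?thesis unfolding l_def[symmetric] using l by (intro exI[of _ "\<lambda>t. c (t / l)"]) simp
qed

lemma affine_geodesic_reverse:
  assumes "affine_geodesic c"
  shows "affine_geodesic (\<lambda>t. c (1 - t))"
proof (rule affine_geodesicI)
  fix s t :: real
  assume "0 \<le> s" "s \<le> 1" "0 \<le> t" "t \<le> 1"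
  then show "dist (c (1 - s)) (c (1 - t)) = dist (c 0) (c 1) * \<bar>s - t\<bar>"
    using affine_geodesicD[OF assms, of "1 - s" "1 - t"] by (simp add: abs_minus_commute)
qed

lemma geodesic_segment_affine_geodesic:
  assumes "affine_geodesic c"
  shows "geodesic_segment (c 0) (c 1) (c ` {0..1})"
proof -
  obtain \<gamma> where \<gamma>: "geodesic (dist (c 0) (c 1)) \<gamma>" "\<forall>t\<in>{0..1}. \<gamma> (dist (c 0) (c 1) * t) = c t"
    using affine_geodesic_unit_speed[OF assms] by blast
  have "c ` {0..1} = (\<lambda>t. \<gamma> (dist (c 0) (c 1) * t)) ` {0..1}" using \<gamma>(2) by auto
  also have "\<dots> = \<gamma> ` ((*) (dist (c 0) (c 1)) ` {0..1})" by (simp only: image_image)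
  also have "\<dots> = \<gamma> ` {0..dist (c 0) (c 1)}" by (simp add: image_mult_atLeastAtMost_if)
  finally show ?thesis using \<gamma>(1) bspec[OF \<gamma>(2), of 0] bspec[OF \<gamma>(2), of 1]
    unfolding geodesic_segment_def by (intro exI[of _ "dist (c 0) (c 1)"] exI[of _ \<gamma>]) simp
qed

text \<open>Polar coordinates around the first basis vector; \<open>q\<close> is the cosine of the longitude.\<close>

definition sphere_point :: "real \<Rightarrow> real \<Rightarrow> real \<Rightarrow> real ^ 3" where
  "sphere_point \<kappa> a q = vector [cos a / sqrt \<kappa>, sin a * q / sqrt \<kappa>, sin a * sqrt (1 - q\<^sup>2) / sqrt \<kappa>]"

text \<open>When \<open>q\<close> and \<open>r\<close> are cosines of longitudes in
  \<open>[0, pi]\<close>, the last factor is the cosine of the difference of the longitudes: this is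
  the spherical law of cosines.\<close>

lemma inner_sphere_point:
  assumes "0 < \<kappa>"
  shows "\<kappa> * (sphere_point \<kappa> a q \<bullet> sphere_point \<kappa> b r) =
    cos a * cos b + sin a * sin b * (q * r + sqrt (1 - q\<^sup>2) * sqrt (1 - r\<^sup>2))"
  using assms by (simp add: sphere_point_def inner_vec_def sum_3 field_simps)

text \<open>The distance bound is a quarter of a great circle of the model sphere. Scaled by
  \<open>sqrt \<kappa>\<close>, distances stay below \<open>pi / 2\<close>: their cosines are
  positive, and three sides add up to less than \<open>2 * pi / sqrt \<kappa>\<close>, so comparison
  applies to every triangle.\<close>

locale small_CAT =
  fixes \<kappa> :: real and X :: "'a::metric_space itself"
  assumes \<kappa>: "0 < \<kappa>" and uniquely_geodesic: "uniquely_geodesic TYPE('a)" and CAT: "CAT \<kappa> TYPE('a)"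
    and dist_less: "\<And>y z :: 'a. dist y z < pi / (2 * sqrt \<kappa>)"
begin

lemma scaled_dist_less: "sqrt \<kappa> * dist y (z::'a) < pi / 2"
  using dist_less[of y z] \<kappa> by (simp add: field_simps)

lemma affine_geodesic_exists:
  fixes y z :: 'a
  obtains c where "affine_geodesic c" "c 0 = y" "c 1 = z"
proof -
  obtain l \<gamma> where "geodesic l \<gamma>" "\<gamma> 0 = y" "\<gamma> l = z"
    using uniquely_geodesic unfolding uniquely_geodesic_def geodesic_segment_def by metis
  with that[of "\<lambda>t. \<gamma> (l * t)"] show thesis by (simp add: affine_geodesic_rescale)
qed

text \<open>\<open>Q\<close> is the cosine of the comparison angle at the common vertex, solved from
  the spherical law of cosines, and the bound is the distance of the comparison points of
  \<open>c s\<close> and \<open>e t\<close>. The \<open>arccos\<close> form is what gets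
  differentiated in the first variation, the \<open>cos\<close> form is what concavity
  needs.\<close>

lemma hinge:
  fixes c e :: "real \<Rightarrow> 'a"
  assumes c: "affine_geodesic c" and e: "affine_geodesic e" and "c 0 = e 0"
    and L: "L = sqrt \<kappa> * dist (c 0) (c 1)" "0 < L" and M: "M = sqrt \<kappa> * dist (e 0) (e 1)" "0 < M"
    and st: "0 \<le> s" "s \<le> 1" "0 \<le> t" "t \<le> 1"
    and Q: "Q = (cos (sqrt \<kappa> * dist (c 1) (e 1)) - cos L * cos M) / (sin L * sin M)"
  shows "\<bar>Q\<bar> \<le> 1"
    and "sqrt \<kappa> * dist (c s) (e t) \<le> arccos (cos (s * L) * cos (t * M) + sin (s * L) * sin (t * M) * Q)"
    and "cos (s * L) * cos (t * M) + sin (s * L) * sin (t * M) * Q \<le> cos (sqrt \<kappa> * dist (c s) (e t))"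
proof -
  define k where "k = sqrt \<kappa>"
  have k: "0 < k" using \<kappa> by (simp add: k_def)
  define D where "D = k * dist (c 1) (e 1)"
  have lt: "k * dist y z < pi / 2" for y z :: 'a using scaled_dist_less by (simp add: k_def)
  have LM: "L < pi / 2" "M < pi / 2" "D < pi / 2" "0 \<le> D"
    using lt k by (auto simp: L M D_def k_def)
  have sin: "0 < sin L" "0 < sin M" using LM L(2) M(2) by (auto intro!: sin_gt_zero2)
  have tri: "D \<le> L + M" "L \<le> D + M" "M \<le> D + L"
    using k dist_triangle[of "c 1" "e 1" "c 0"] dist_triangle[of "c 0" "c 1" "e 1"]
      dist_triangle[of "e 0" "e 1" "c 1"] \<open>c 0 = e 0\<close>
    by (auto simp: L M D_def k_def dist_commute simp flip: distrib_left)
  have cosD: "cos D = cos L * cos M + sin L * sin M * Q"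
    using sin by (simp add: Q D_def k_def)
  \<comment> \<open>The triangle inequalities confine \<open>Q\<close> to \<open>[-1, 1]\<close>;
    the extreme values belong to the third side being \<open>L + M\<close> or
    \<open>\<bar>L - M\<bar>\<close>.\<close>
  have "cos (L + M) \<le> cos D" using tri LM L(2) M(2) by (intro cos_monotone_0_pi_le) auto
  then have "sin L * sin M * (- 1) \<le> sin L * sin M * Q" by (simp add: cosD cos_add)
  then have "- 1 \<le> Q" using sin by (subst (asm) mult_le_cancel_left_pos) auto
  have "cos D \<le> cos \<bar>L - M\<bar>" using tri LM by (intro cos_monotone_0_pi_le) auto
  then have "sin L * sin M * Q \<le> sin L * sin M * 1" by (simp add: cosD cos_diff)
  then have "Q \<le> 1" using sin by (subst (asm) mult_le_cancel_left_pos) auto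
  with \<open>- 1 \<le> Q\<close> show Q1: "\<bar>Q\<bar> \<le> 1" by simp
  then have Q2: "Q\<^sup>2 \<le> 1" by (simp add: abs_square_le_1)

  define P where "P a q = sphere_point \<kappa> a q" for a q
  have arccos: "arccos (\<kappa> * (P a q \<bullet> P b r)) / k = d"
    if "cos a * cos b + sin a * sin b * (q * r + sqrt (1 - q\<^sup>2) * sqrt (1 - r\<^sup>2)) = cos (k * d)"
      "0 \<le> d" "k * d < pi / 2" for a b q r d
  proof -
    have "0 \<le> k * d" "k * d \<le> pi" using that k pi_gt_zero by (simp, linarith)
    with that k show ?thesis by (simp add: P_def inner_sphere_point[OF \<kappa>] arccos_cos)
  qed
  have surface: "P a q \<in> model_surface \<kappa>" if "q\<^sup>2 \<le> 1" for a q
  proof -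
    have "\<kappa> * (P a q \<bullet> P a q) = 1"
      using that by (simp add: P_def inner_sphere_point[OF \<kappa>] flip: power2_eq_square)
    then have "P a q \<bullet> P a q = 1 / \<kappa>" using \<kappa> by (simp add: field_simps)
    then show ?thesis by (simp add: model_surface_def norm_eq_sqrt_inner real_sqrt_divide)
  qed
  have dists: "dist (c s) (c 0) = dist (c 0) (c 1) * s" "dist (c 1) (c s) = dist (c 0) (c 1) * (1 - s)"
      "dist (e 0) (e t) = dist (e 0) (e 1) * t" "dist (e t) (e 1) = dist (e 0) (e 1) * (1 - t)"
    using affine_geodesicD[OF c, of s 0] affine_geodesicD[OF c, of 1 s]
      affine_geodesicD[OF e, of 0 t] affine_geodesicD[OF e, of t 1] st by auto

  \<comment> \<open>Side \<open>i\<close> runs from vertex \<open>i\<close> to vertex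
    \<open>i + 1\<close>, so side 1 is \<open>c\<close> traversed backwards to the common vertex
    \<open>c 0\<close>, and side 2 is \<open>e\<close>. The closing side only has to exist. In the
    type \<open>3\<close> the index 3 is 0.\<close>
  define v :: "3 \<Rightarrow> 'a" where "v i = (if i = 1 then c 1 else if i = 2 then c 0 else e 1)" for i
  \<comment> \<open>The common vertex sits at the pole, \<open>c\<close> on the meridian of
    longitude 0 and \<open>e\<close> on the meridian whose longitude has cosine \<open>Q\<close>;
    comparison points then differ from the vertices only in the polar distance.\<close>
  define w :: "3 \<Rightarrow> real ^ 3" where "w i = (if i = 1 then P L 1 else if i = 2 then P 0 1 else P M Q)" for i
  obtain S3 where S3: "geodesic_segment (e 1) (c 1) S3"
    using uniquely_geodesic unfolding uniquely_geodesic_def by blast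
  define S :: "3 \<Rightarrow> 'a set" where
    "S i = (if i = 1 then c ` {0..1} else if i = 2 then e ` {0..1} else S3)" for i
  have idx: "(3::3) \<noteq> 1" "(3::3) \<noteq> 2" "(2::3) \<noteq> 1" "(3::3) + 1 = 1" "(2::3) + 1 = 3" "(1::3) + 1 = 2"
    "(0::3) \<noteq> 1" "(0::3) \<noteq> 2" by simp_all
  have rev: "c ` {0..1} = (\<lambda>t. c (1 - t)) ` {0..1}"
    by (auto simp: image_iff intro!: bexI[of _ "1 - _"])
  have "geodesic_triangle v S"
    unfolding geodesic_triangle_def forall_3
    using S3 geodesic_segment_affine_geodesic[OF e] \<open>c 0 = e 0\<close>
      geodesic_segment_affine_geodesic[OF affine_geodesic_reverse[OF c]]
    by (simp add: v_def S_def rev)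
  moreover have "perimeter v < 2 * pi / sqrt \<kappa>"
  proof -
    have "perimeter v < 3 * (pi / (2 * sqrt \<kappa>))"
      using dist_less[of "c 1" "c 0"] dist_less[of "c 0" "e 1"] dist_less[of "e 1" "c 1"]
      by (simp add: perimeter_def sum_3 v_def)
    also have "\<dots> < 2 * pi / sqrt \<kappa>" using \<kappa> by (simp add: field_simps)
    finally show ?thesis .
  qed
  moreover have "comparison_triangle \<kappa> v w"
    unfolding comparison_triangle_def forall_3 model_dist_def k_def[symmetric] idx
    using Q2 LM lt surface \<open>c 0 = e 0\<close> cosD
    by (auto simp: v_def w_def idx L M D_def k_def[symmetric] dist_commute mult.commute intro!: arccos)
  moreover have "c s \<in> S 1" "e t \<in> S 2" using st by (auto simp: S_def)
  moreover have "comparison_point \<kappa> v w 1 (c s) (P (s * L) 1)"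
  proof -
    have "k * dist (c 1) (c s) = L - s * L" "k * dist (c s) (c 0) = s * L"
      by (simp_all add: dists L k_def algebra_simps)
    then have "arccos (\<kappa> * (P L 1 \<bullet> P (s * L) 1)) / k = dist (c 1) (c s)"
      "arccos (\<kappa> * (P (s * L) 1 \<bullet> P 0 1)) / k = dist (c s) (c 0)"
      using lt by (auto intro!: arccos simp del: less_divide_eq_numeral1 simp: cos_diff)
    then show ?thesis
      using surface by (simp add: comparison_point_def model_dist_def v_def w_def idx flip: k_def)
  qed
  moreover have "comparison_point \<kappa> v w 2 (e t) (P (t * M) Q)"
  proof -
    have "k * dist (e 0) (e t) = t * M" "k * dist (e t) (e 1) = M - t * M"
      by (simp_all add: dists M k_def algebra_simps)
    then have "arccos (\<kappa> * (P 0 1 \<bullet> P (t * M) Q)) / k = dist (e 0) (e t)"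
      "arccos (\<kappa> * (P (t * M) Q \<bullet> P M Q)) / k = dist (e t) (e 1)"
      using lt Q2 by (auto intro!: arccos simp del: less_divide_eq_numeral1
        simp: cos_diff simp flip: power2_eq_square)
    then show ?thesis
      using surface Q2 \<open>c 0 = e 0\<close>
      by (simp add: comparison_point_def model_dist_def v_def w_def idx flip: k_def)
  qed
  ultimately have "dist (c s) (e t) \<le> model_dist \<kappa> (P (s * L) 1) (P (t * M) Q)"
    using CAT unfolding CAT_def by blast
  moreover define u where "u = cos (s * L) * cos (t * M) + sin (s * L) * sin (t * M) * Q"
  ultimately have le: "k * dist (c s) (e t) \<le> arccos u"
    using k by (simp add: model_dist_def P_def inner_sphere_point[OF \<kappa>] field_simps flip: k_def)
  then show "sqrt \<kappa> * dist (c s) (e t) \<le> arccos (cos (s * L) * cos (t * M) + sin (s * L) * sin (t * M) * Q)"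
    by (simp add: u_def k_def)
  \<comment> \<open>\<open>cos\<close> undoes \<open>arccos\<close> only on \<open>[-1, 1]\<close>.
    The values of \<open>u\<close> for \<open>Q = - 1\<close> and \<open>Q = 1\<close> are the
    cosines of \<open>s * L + t * M\<close> and \<open>s * L - t * M\<close>.\<close>
  have "\<bar>u\<bar> \<le> 1"
  proof -
    have sL: "s * L \<le> L" "t * M \<le> M" "0 \<le> s * L" "0 \<le> t * M"
      using st L(2) M(2) by (auto simp: mult_left_le_one_le)
    then have nn: "0 \<le> sin (s * L) * sin (t * M)"
      using LM by (intro mult_nonneg_nonneg[of "sin _"] sin_ge_zero) auto
    have "u \<le> cos (s * L - t * M)" "cos (s * L + t * M) \<le> u"
      using mult_left_le[OF \<open>Q \<le> 1\<close> nn] mult_left_mono[OF \<open>- 1 \<le> Q\<close> nn]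
      by (auto simp: u_def cos_diff cos_add)
    then show ?thesis
      using cos_le_one[of "s * L - t * M"] cos_ge_minus_one[of "s * L + t * M"] by linarith
  qed
  then have "u = cos (arccos u)" "arccos u \<le> pi" by (auto simp: cos_arccos_abs arccos_ubound)
  with le k have "u \<le> cos (k * dist (c s) (e t))"
    using cos_monotone_0_pi_le[OF _ le] by auto
  then show "cos (s * L) * cos (t * M) + sin (s * L) * sin (t * M) * Q \<le> cos (sqrt \<kappa> * dist (c s) (e t))"
    by (simp add: u_def k_def)
qed

end

section \<open>Projections in the product with the real line\<close>

text \<open>A segment of the product is a pair of an affinely parametrised geodesic and an affine
  function, so convexity is stated for such pairs directly, without geodesics of the product metric.
  Constant \<open>c\<close> gives the vertical segments.\<close>

definition product_convex :: "('a::metric_space \<times> real) set \<Rightarrow> bool" where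
  "product_convex C \<longleftrightarrow> (\<forall>c a b. affine_geodesic c \<and> (c 0, a) \<in> C \<and> (c 1, b) \<in> C \<longrightarrow>
     (\<forall>t\<in>{0..1}. (c t, a + t * (b - a)) \<in> C))"

lemma product_convexD:
  assumes "product_convex C" "affine_geodesic c" "(c 0, a) \<in> C" "(c 1, b) \<in> C" "0 \<le> t" "t \<le> 1"
  shows "(c t, a + t * (b - a)) \<in> C"
  using assms by (simp add: product_convex_def)

context small_CAT
begin

text \<open>Comparison at the far end of the hinge (\<open>s = 1\<close>) bounds
  \<open>sin M * cos\<close> of the distance below by a combination of the end values with weights
  \<open>sin ((1 - t) * M)\<close> and \<open>sin (t * M)\<close>. Concavity of \<open>sin\<close>
  lowers the weights to the affine ones, which is legitimate because the end values are
  nonnegative.\<close>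

lemma cos_dist_concave:
  fixes e :: "real \<Rightarrow> 'a"
  assumes e: "affine_geodesic e" and t: "0 \<le> t" "t \<le> 1"
  shows "(1 - t) * cos (sqrt \<kappa> * dist z (e 0)) + t * cos (sqrt \<kappa> * dist z (e 1))
    \<le> cos (sqrt \<kappa> * dist z (e t))"
proof (cases "e 0 = e 1")
  case True
  then have "e t = e 0" using affine_geodesicD[OF e, of t 0] t by simp
  with True show ?thesis by (simp add: algebra_simps)
next
  case False
  define k where "k = sqrt \<kappa>"
  have k: "0 < k" using \<kappa> by (simp add: k_def)
  define L where "L = k * dist z (e 0)"
  define M where "M = k * dist (e 0) (e 1)"
  define D where "D = k * dist z (e 1)"
  have lt: "L < pi / 2" "M < pi / 2" "D < pi / 2"
    using scaled_dist_less by (auto simp: L_def M_def D_def k_def)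
  have M: "0 < M" "0 < sin M" using False k lt by (auto simp: M_def intro!: sin_gt_zero2)
  have "0 \<le> L" "0 \<le> D" using k by (simp_all add: L_def D_def)
  with lt have pos: "0 \<le> cos L" "0 \<le> cos D" by (auto intro!: cos_ge_zero)
  have *: "sin M * cos (t * M) - cos M * sin (t * M) = sin ((1 - t) * M)"
    by (simp add: left_diff_distrib sin_diff)
  have "sin ((1 - t) * M) * cos L + sin (t * M) * cos D \<le> sin M * cos (k * dist z (e t))"
  proof (cases "z = e 0")
    case True
    then have "dist z (e t) = dist (e 0) (e 1) * t" using affine_geodesicD[OF e, of 0 t] t by simp
    then have "k * dist z (e t) = t * M" by (simp add: M_def)
    with True show ?thesis by (simp add: L_def D_def flip: * M_def)
  next
    case False
    obtain c where c: "affine_geodesic c" "c 0 = e 0" "c 1 = z" using affine_geodesic_exists .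
    have L: "0 < L" "0 < sin L" using False k lt by (auto simp: L_def intro!: sin_gt_zero2)
    let ?Q = "(cos D - cos L * cos M) / (sin L * sin M)"
    have "cos (1 * L) * cos (t * M) + sin (1 * L) * sin (t * M) * ?Q \<le> cos (k * dist (c 1) (e t))"
      unfolding k_def
      by (rule hinge(3)[OF c(1) e]) (use c L M t in \<open>auto simp: L_def M_def D_def k_def dist_commute\<close>)
    then have "sin M * (cos L * cos (t * M) + sin L * sin (t * M) * ?Q) \<le> sin M * cos (k * dist z (e t))"
      using c M by simp
    moreover have "sin M * (cos L * cos (t * M) + sin L * sin (t * M) * ?Q) =
      sin ((1 - t) * M) * cos L + sin (t * M) * cos D"
      unfolding *[symmetric] using L M by (simp add: field_simps)
    ultimately show ?thesis by simp
  qed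
  moreover have "(1 - t) * sin M * cos L \<le> sin ((1 - t) * M) * cos L"
    "t * sin M * cos D \<le> sin (t * M) * cos D"
    using sin_concave_scale[of "1 - t" M] sin_concave_scale[of t M] t M lt pos
    by (auto intro!: mult_right_mono)
  ultimately have "sin M * ((1 - t) * cos L + t * cos D) \<le> sin M * cos (k * dist z (e t))"
    by (simp add: algebra_simps)
  with M show ?thesis by (simp add: L_def D_def k_def)
qed

text \<open>The bound \<open>h\<close> is the squared distance of the comparison points. What matters is that \<open>B\<close> does not
  depend on \<open>s\<close>.\<close>

lemma first_variation_bound:
  fixes c e :: "real \<Rightarrow> 'a"
  assumes c: "affine_geodesic c" and e: "affine_geodesic e" and "c 0 = e 0"
    and small: "sqrt \<kappa> * dist (c 0) (c 1) \<le> pi / 4" and s: "0 < s" "s \<le> 1"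
  obtains B h where "\<And>t. 0 \<le> t \<Longrightarrow> t \<le> 1 \<Longrightarrow> (dist (c s) (e t))\<^sup>2 \<le> h t"
    "h 0 = (s * dist (c 0) (c 1))\<^sup>2" "(h has_real_derivative s * B) (at 0)"
    "B \<le> (dist (c 1) (e 1))\<^sup>2 - (dist (c 0) (c 1))\<^sup>2"
    "e 0 \<noteq> e 1 \<Longrightarrow> B < (dist (c 1) (e 1))\<^sup>2 - (dist (c 0) (c 1))\<^sup>2"
proof -
  define k where "k = sqrt \<kappa>"
  have k: "0 < k" using \<kappa> by (simp add: k_def)
  consider "c 0 = c 1" | "c 0 \<noteq> c 1" "e 0 = e 1" | "c 0 \<noteq> c 1" "e 0 \<noteq> e 1" by blast
  then show thesis
  proof cases
    \<comment> \<open>There is no angle when a side degenerates; \<open>B = 0\<close> works because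
      the squared distance then has no first-order term.\<close>
    case 1
    have "c s = e 0" using affine_geodesicD[OF c, of s 0] s 1 \<open>c 0 = e 0\<close> by simp
    then have "dist (c s) (e t) = dist (e 0) (e 1) * t" if "0 \<le> t" "t \<le> 1" for t
      using affine_geodesicD[OF e, of 0 t] that by simp
    moreover have "((\<lambda>t. (dist (e 0) (e 1) * t)\<^sup>2) has_real_derivative s * 0) (at 0)"
      by (auto intro!: derivative_eq_intros)
    ultimately show thesis
      using 1 \<open>c 0 = e 0\<close> by (intro that[of "\<lambda>t. (dist (e 0) (e 1) * t)\<^sup>2" 0]) auto
  next
    case 2
    have "dist (c s) (e t) = s * dist (c 0) (c 1)" if "0 \<le> t" "t \<le> 1" for t
    proof -
      have "e t = c 0" using affine_geodesicD[OF e, of t 0] that 2 \<open>c 0 = e 0\<close> by simp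
      then show ?thesis using affine_geodesicD[OF c, of s 0] s by simp
    qed
    then show thesis using 2 \<open>c 0 = e 0\<close>
      by (intro that[of "\<lambda>_. (s * dist (c 0) (c 1))\<^sup>2" 0]) (auto simp: dist_commute)
  next
    case 3
    define L where "L = k * dist (c 0) (c 1)"
    define M where "M = k * dist (e 0) (e 1)"
    define D where "D = k * dist (c 1) (e 1)"
    have lt: "L \<le> pi / 4" "M < pi / 2" "D < pi / 2" "0 \<le> D"
      using scaled_dist_less small k by (auto simp: L_def M_def D_def k_def)
    have pos: "0 < L" "0 < M" using 3 k by (auto simp: L_def M_def)
    have "s * L \<le> L" using s pos mult_left_le_one_le[of L s] by simp
    with lt(1) have "s * L < pi / 2" using pi_gt_zero by linarith
    with pos s have sin: "0 < sin L" "0 < sin M" "0 < sin (s * L)"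
      using lt by (auto intro: sin_gt_zero2)
    define Q where "Q = (cos D - cos L * cos M) / (sin L * sin M)"
    have hinge: "\<bar>Q\<bar> \<le> 1"
      "k * dist (c s) (e t) \<le> arccos (cos (s * L) * cos (t * M) + sin (s * L) * sin (t * M) * Q)"
      if "0 \<le> t" "t \<le> 1" for t
      using hinge(1,2)[OF c e \<open>c 0 = e 0\<close> _ _ _ _ _ _ that, of L M s Q] pos s
      by (auto simp: L_def M_def D_def Q_def k_def)
    define h where
      "h t = (arccos (cos (s * L) * cos (t * M) + sin (s * L) * sin (t * M) * Q) / k)\<^sup>2" for t
    have "L\<^sup>2 - 2 * L * M * Q < D\<^sup>2"
      using hinge(1)[of 0] lt pos sin
      by (intro spherical_cosine_rule_strict) (auto simp: Q_def)
    then have "(L\<^sup>2 - 2 * L * M * Q) / k\<^sup>2 < D\<^sup>2 / k\<^sup>2" using k by (intro divide_strict_right_mono) auto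
    \<comment> \<open>This value of \<open>B\<close> is the first-order term of the Euclidean law of
      cosines. Differentiating the spherical law at \<open>t = 0\<close> gives the same expression
      with \<open>s * L\<close> in place of \<open>L\<close>, so \<open>s\<close> factors
      out.\<close>
    then have B: "- 2 * L * M * Q / k\<^sup>2 < (dist (c 1) (e 1))\<^sup>2 - (dist (c 0) (c 1))\<^sup>2"
      using k by (simp add: L_def D_def power_mult_distrib diff_divide_distrib)
    have sL: "0 \<le> s * L" "s * L \<le> pi"
      using pos s \<open>s * L < pi / 2\<close> pi_gt_zero by (simp, linarith)
    show thesis
    proof (rule that)
      show "(dist (c s) (e t))\<^sup>2 \<le> h t" if "0 \<le> t" "t \<le> 1" for t
        unfolding h_def using hinge(2)[OF that] k
        by (intro power_mono) (auto simp: pos_le_divide_eq mult.commute)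
      show "h 0 = (s * dist (c 0) (c 1))\<^sup>2"
        using sL k by (simp add: h_def arccos_cos) (simp add: L_def)
      have "(cos (s * L))\<^sup>2 < 1"
        using zero_less_power[OF sin(3), of 2] sin_cos_squared_add[of "s * L"] by linarith
      then have "\<bar>cos (s * L)\<bar> < 1" by (simp add: abs_square_less_1)
      moreover have "sqrt (1 - (cos (s * L))\<^sup>2) = sin (s * L)"
        using sin by (simp add: sin_squared_eq[symmetric])
      ultimately show "(h has_real_derivative s * (- 2 * L * M * Q / k\<^sup>2)) (at 0)"
        unfolding h_def using k sin sL
        by (auto intro!: derivative_eq_intros simp: arccos_cos power2_eq_square)
    qed (use B in auto)
  qed
qed

end

lemma dist_Pair_power2: "(dist (a, b) (c, d :: real))\<^sup>2 = (dist a c)\<^sup>2 + (b - d)\<^sup>2"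
  by (simp add: dist_Pair_Pair dist_real_def)

section \<open>Prolonging normal segments of convex sets\<close>

context small_CAT
begin

text \<open>If some \<open>w\<close> were at least as near to the far point, moving from the foot
  \<open>(c 0, d)\<close> towards \<open>w\<close> would have a negative first-order term at the far
  point. This term scales by \<open>s\<close>, so the intermediate point would also get closer,
  against local minimality. The lemma serves twice: to prolong a short normal segment to a fixed
  length, and with \<open>s = 1\<close> to make a nearest point unique.\<close>

lemma local_projection_extends:
  fixes c :: "real \<Rightarrow> 'a"
  assumes C: "product_convex C" and d: "(c 0, d) \<in> C" and c: "affine_geodesic c"
    and small: "sqrt \<kappa> * dist (c 0) (c 1) \<le> pi / 4" and s: "0 < s" "s \<le> 1" and "0 < \<epsilon>"
    and nearest: "\<And>v. v \<in> C \<Longrightarrow> dist v (c 0, d) < \<epsilon> \<Longrightarrow>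
      dist (c s, d + s * (p - d)) (c 0, d) \<le> dist (c s, d + s * (p - d)) v"
    and w: "w \<in> C" "w \<noteq> (c 0, d)"
  shows "dist (c 1, p) (c 0, d) < dist (c 1, p) w"
proof (rule ccontr)
  assume "\<not> dist (c 1, p) (c 0, d) < dist (c 1, p) w"
  then have "(dist (c 1, p) w)\<^sup>2 \<le> (dist (c 1, p) (c 0, d))\<^sup>2" by (simp add: power_mono)
  moreover obtain w1 w2 where w12: "w = (w1, w2)" by (cases w)
  ultimately have le: "(dist (c 1) w1)\<^sup>2 + (p - w2)\<^sup>2 \<le> (dist (c 0) (c 1))\<^sup>2 + (p - d)\<^sup>2"
    by (simp add: dist_Pair_power2 dist_commute[of "c 1" "c 0"])
  obtain e where e: "affine_geodesic e" "e 0 = c 0" "e 1 = w1" using affine_geodesic_exists .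
  obtain B h where h: "\<And>t. 0 \<le> t \<Longrightarrow> t \<le> 1 \<Longrightarrow> (dist (c s) (e t))\<^sup>2 \<le> h t"
    "h 0 = (s * dist (c 0) (c 1))\<^sup>2" "(h has_real_derivative s * B) (at 0)"
    and B: "B \<le> (dist (c 1) w1)\<^sup>2 - (dist (c 0) (c 1))\<^sup>2"
    "c 0 \<noteq> w1 \<Longrightarrow> B < (dist (c 1) w1)\<^sup>2 - (dist (c 0) (c 1))\<^sup>2"
    by (rule first_variation_bound[OF c e(1) e(2)[symmetric] small s, unfolded e]) blast
  \<comment> \<open>\<open>G t\<close> bounds the squared distance from the intermediate point to
    the point at parameter \<open>t\<close> on the segment towards \<open>w\<close>, with equality
    at \<open>t = 0\<close>.\<close>
  define G where "G t = h t + (s * (p - d) - t * (w2 - d))\<^sup>2" for t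
  have der: "(G has_real_derivative s * (B - 2 * (p - d) * (w2 - d))) (at 0)"
    unfolding G_def by (auto intro!: derivative_eq_intros h(3) simp: algebra_simps)
  \<comment> \<open>Strictness comes from the horizontal part if \<open>w1\<close> differs from
    \<open>c 0\<close>, and otherwise from the square of the height difference.\<close>
  have "B - 2 * (p - d) * (w2 - d) < 0"
  proof -
    have "(p - w2)\<^sup>2 = (p - d)\<^sup>2 - 2 * (p - d) * (w2 - d) + (w2 - d)\<^sup>2"
      by (simp add: power2_eq_square algebra_simps)
    moreover have "c 0 \<noteq> w1 \<or> 0 < (w2 - d)\<^sup>2" using w w12 by auto
    ultimately show ?thesis using B le zero_le_power2[of "w2 - d"] by linarith
  qed
  then have "s * (B - 2 * (p - d) * (w2 - d)) < 0" using s(1) by (rule mult_pos_neg[rotated])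
  from DERIV_neg_dec_right[OF der this]
  obtain \<eta> where \<eta>: "0 < \<eta>" "\<And>t. 0 < t \<Longrightarrow> t < \<eta> \<Longrightarrow> G t < G 0" by auto
  define N where "N = dist w (c 0, d)"
  have N: "0 < N" using w by (simp add: N_def)
  \<comment> \<open>Below \<open>\<eta>\<close> the function \<open>G\<close> is smaller than
    \<open>G 0\<close>, up to 1 the segment stays in \<open>C\<close>, and the last bound keeps the
    moved point within \<open>\<epsilon>\<close> of the foot.\<close>
  define t where "t = min (min (\<eta> / 2) 1) (\<epsilon> / (2 * N))"
  have t: "0 < t" "t < \<eta>" "t \<le> 1" "t * N < \<epsilon>"
  proof -
    have "t * N \<le> \<epsilon> / (2 * N) * N" using N by (intro mult_right_mono) (auto simp: t_def)
    with N \<open>0 < \<epsilon>\<close> show "t * N < \<epsilon>" by simp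
  qed (use \<eta>(1) \<open>0 < \<epsilon>\<close> N in \<open>auto simp: t_def min_less_iff_disj\<close>)
  let ?v = "(e t, d + t * (w2 - d))"
  have "?v \<in> C" using C d e w(1) w12 t unfolding product_convex_def by auto
  moreover have "dist ?v (c 0, d) < \<epsilon>"
  proof -
    have "dist (e t) (c 0) = dist w1 (c 0) * t"
      using affine_geodesicD[OF e(1), of t 0] t e by (simp add: dist_commute)
    then have "(dist ?v (c 0, d))\<^sup>2 = (t * N)\<^sup>2"
      by (simp add: dist_Pair_power2 N_def w12 power_mult_distrib distrib_left)
    then have "dist ?v (c 0, d) = t * N" using t N by (simp add: power2_eq_iff_nonneg)
    with t show ?thesis by simp
  qed
  ultimately have "(dist (c s, d + s * (p - d)) (c 0, d))\<^sup>2 \<le> (dist (c s, d + s * (p - d)) ?v)\<^sup>2"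
    by (intro power_mono nearest) auto
  also have "\<dots> \<le> G t" using h(1)[of t] t by (simp add: dist_Pair_power2 G_def)
  also have "\<dots> < G 0" using \<eta> t by blast
  also have "\<dots> = (dist (c s, d + s * (p - d)) (c 0, d))\<^sup>2"
    using affine_geodesicD[OF c, of s 0] s h(2) by (simp add: dist_Pair_power2 G_def power_mult_distrib)
  finally show False by simp
qed

text \<open>The extension property lengthens a geodesic only at its far end. So the geodesic from
  \<open>d\<close> through \<open>c\<close> is extended, its first half of length
  \<open>R / 2\<close> is reversed, and the result is extended beyond \<open>d\<close>. The radius
  \<open>R / 4\<close> keeps \<open>c\<close> on the retained half and the point at time
  \<open>R / 2\<close> in the ball where extension is allowed.\<close>

lemma extend_both_ways:
  fixes c d x :: 'a
  assumes ext: "geodesic_extension_around x R" and cd: "c \<in> ball x (R / 4)" "d \<in> ball x (R / 4)" "c \<noteq> d"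
  obtains \<Lambda> where "\<Lambda> 0 = d" "\<Lambda> (dist d c) = c"
    "\<And>s t. \<bar>s\<bar> \<le> R / 2 \<Longrightarrow> \<bar>t\<bar> \<le> R / 2 \<Longrightarrow> dist (\<Lambda> s) (\<Lambda> t) = \<bar>s - t\<bar>"
proof -
  have R: "0 < R" using ext by (simp add: geodesic_extension_around_def)
  have extend: "\<exists>\<gamma>'. geodesic R \<gamma>' \<and> (\<forall>t\<in>{0..l}. \<gamma>' t = \<gamma> t)"
    if "geodesic l \<gamma>" "\<gamma> 0 \<in> ball x R" "\<gamma> l \<in> ball x R" "0 < l" "l < R" for l \<gamma>
  proof -
    have "dist (\<gamma> 0) (\<gamma> l) = l" using that by (simp add: geodesic_dist_ends)
    with that ext show ?thesis unfolding geodesic_extension_around_def by fastforce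
  qed
  have l: "0 < dist d c" "dist d c < R / 2"
    using cd dist_triangle_half_l[of d x "R / 2" c] by (auto simp: dist_commute)
  obtain a where a: "affine_geodesic a" "a 0 = d" "a 1 = c" using affine_geodesic_exists .
  obtain \<gamma> where "geodesic (dist d c) \<gamma>" "\<forall>t\<in>{0..1}. \<gamma> (dist d c * t) = a t"
    using affine_geodesic_unit_speed[OF a(1)] unfolding a by blast
  then have \<gamma>: "geodesic (dist d c) \<gamma>" "\<gamma> 0 = d" "\<gamma> (dist d c) = c"
    using a by (force dest: bspec[of _ _ 0] bspec[of _ _ 1])+
  then obtain \<gamma>1 where \<gamma>1: "geodesic R \<gamma>1" "\<forall>t\<in>{0..dist d c}. \<gamma>1 t = \<gamma> t"
    using extend[of "dist d c" \<gamma>] cd l R by auto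
  have \<gamma>10: "\<gamma>1 0 = d" "\<gamma>1 (dist d c) = c" using \<gamma> \<gamma>1 by auto
  have "dist x (\<gamma>1 (R / 2)) < R"
  proof -
    have "dist d (\<gamma>1 (R / 2)) = R / 2" using \<gamma>1(1) R \<gamma>10 by (auto simp: geodesic_def)
    then show ?thesis using cd R dist_triangle[of x "\<gamma>1 (R / 2)" d] by simp
  qed
  moreover have "geodesic (R / 2) (\<lambda>t. \<gamma>1 (R / 2 - t))"
    using \<gamma>1(1) R by (auto simp: geodesic_def)
  ultimately obtain \<gamma>2 where \<gamma>2: "geodesic R \<gamma>2" "\<forall>t\<in>{0..R / 2}. \<gamma>2 t = \<gamma>1 (R / 2 - t)"
    using extend[of "R / 2" "\<lambda>t. \<gamma>1 (R / 2 - t)"] \<gamma>10 cd R by auto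
  show thesis
  proof (rule that[of "\<lambda>t. \<gamma>2 (R / 2 - t)"])
    show "\<gamma>2 (R / 2 - 0) = d" "\<gamma>2 (R / 2 - dist d c) = c" 
      using bspec[OF \<gamma>2(2), of "R / 2"] bspec[OF \<gamma>2(2), of "R / 2 - dist d c"] \<gamma>10 R l by simp_all
    show "dist (\<gamma>2 (R / 2 - s)) (\<gamma>2 (R / 2 - t)) = \<bar>s - t\<bar>" if "\<bar>s\<bar> \<le> R / 2" "\<bar>t\<bar> \<le> R / 2" for s t
    proof -
      have "R / 2 - s \<in> {0..R}" "R / 2 - t \<in> {0..R}" using that by auto
      then have "dist (\<gamma>2 (R / 2 - s)) (\<gamma>2 (R / 2 - t)) = \<bar>(R / 2 - s) - (R / 2 - t)\<bar>"
        using \<gamma>2(1) by (simp only: geodesic_def)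
      then show ?thesis by simp
    qed
  qed
qed

text \<open>\<open>\<alpha>\<close> and \<open>\<beta>\<close> are the components of the unit vector
  from \<open>(d1, d2)\<close> to \<open>(c1, c2)\<close>. Each of the two points is the foot of a
  normal prolonged to length \<open>\<delta>\<close> through the other one; the overlap of the two
  prolongations accounts for the term \<open>dist c1 d1\<close>. The length \<open>\<delta>\<close>
  does not depend on how close the pair is.\<close>

lemma opposite_normals:
  fixes x :: 'a
  assumes ext: "geodesic_extension_around x R"
    and C: "product_convex C" "(c1, c2) \<in> C" and D: "product_convex D" "(d1, d2) \<in> D"
    and ball: "c1 \<in> ball x (R / 4)" "d1 \<in> ball x (R / 4)"
    and \<delta>: "0 < \<delta>" "\<delta> \<le> R / 4" "sqrt \<kappa> * \<delta> \<le> pi / 4"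
    and cd: "(c1, c2) \<noteq> (d1, d2)" "dist (c1, c2) (d1, d2) \<le> \<delta>"
    and "0 < \<epsilon>"
    and nearest_C: "\<And>v. v \<in> C \<Longrightarrow> dist v (c1, c2) < \<epsilon> \<Longrightarrow> dist (d1, d2) (c1, c2) \<le> dist (d1, d2) v"
    and nearest_D: "\<And>v. v \<in> D \<Longrightarrow> dist v (d1, d2) < \<epsilon> \<Longrightarrow> dist (c1, c2) (d1, d2) \<le> dist (c1, c2) v"
  obtains p q \<alpha> \<beta> where "0 \<le> \<alpha>" "\<alpha>\<^sup>2 + \<beta>\<^sup>2 = 1" "dist d1 p = \<delta> * \<alpha>" "dist c1 q = \<delta> * \<alpha>"
    "dist p q = 2 * \<delta> * \<alpha> - dist c1 d1"
    "\<And>w. w \<in> D \<Longrightarrow> \<delta> \<le> dist (p, d2 + \<delta> * \<beta>) w" "\<And>w. w \<in> C \<Longrightarrow> \<delta> \<le> dist (q, c2 - \<delta> * \<beta>) w"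
proof -
  define N where "N = dist (c1, c2) (d1, d2)"
  have N: "0 < N" "N \<le> \<delta>" using cd by (simp_all add: N_def)
  define \<alpha> where "\<alpha> = dist c1 d1 / N"
  define \<beta> where "\<beta> = (c2 - d2) / N"
  have N2: "N\<^sup>2 = (dist c1 d1)\<^sup>2 + (c2 - d2)\<^sup>2" by (simp add: N_def dist_Pair_power2)
  then have unit: "0 \<le> \<alpha>" "\<alpha>\<^sup>2 + \<beta>\<^sup>2 = 1"
    using N by (auto simp: \<alpha>_def \<beta>_def power_divide simp flip: add_divide_distrib)
  have "\<alpha>\<^sup>2 \<le> 1" using unit(2) zero_le_power2[of \<beta>] by linarith
  then have "\<alpha> \<le> 1" by (simp add: abs_square_le_1)
  have \<alpha>N: "\<alpha> * N = dist c1 d1" and \<beta>N: "N * \<beta> = c2 - d2" using N by (auto simp: \<alpha>_def \<beta>_def)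
  \<comment> \<open>\<open>\<Lambda>\<close> is the horizontal part, parametrised by length in the
    product and hence of speed \<open>\<alpha>\<close>; for a vertical pair it is constant.\<close>
  obtain \<Lambda> where \<Lambda>: "\<Lambda> 0 = d1" "\<Lambda> N = c1"
    "\<And>s t. \<bar>s\<bar> \<le> \<delta> \<Longrightarrow> \<bar>t\<bar> \<le> \<delta> \<Longrightarrow> dist (\<Lambda> s) (\<Lambda> t) = \<alpha> * \<bar>s - t\<bar>"
  proof (cases "c1 = d1")
    case True
    then show thesis by (intro that[of "\<lambda>_. d1"]) (simp_all add: \<alpha>_def)
  next
    case False
    obtain \<Lambda> where \<Lambda>: "\<Lambda> 0 = d1" "\<Lambda> (dist d1 c1) = c1"
      "\<And>s t. \<bar>s\<bar> \<le> R / 2 \<Longrightarrow> \<bar>t\<bar> \<le> R / 2 \<Longrightarrow> dist (\<Lambda> s) (\<Lambda> t) = \<bar>s - t\<bar>"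
      by (rule extend_both_ways[OF ext ball False]) blast
    show thesis
    proof (rule that[of "\<lambda>s. \<Lambda> (\<alpha> * s)"])
      fix s t assume st: "\<bar>s\<bar> \<le> \<delta>" "\<bar>t\<bar> \<le> \<delta>"
      have "\<bar>\<alpha> * r\<bar> \<le> R / 2" if "\<bar>r\<bar> \<le> \<delta>" for r
        using that \<delta> mult_mono[OF \<open>\<alpha> \<le> 1\<close> that] unit(1) by (simp add: abs_mult)
      then show "dist (\<Lambda> (\<alpha> * s)) (\<Lambda> (\<alpha> * t)) = \<alpha> * \<bar>s - t\<bar>"
        using st unit(1) by (simp add: \<Lambda>(3) abs_mult flip: right_diff_distrib)
    qed (use \<Lambda> \<alpha>N in \<open>auto simp: dist_commute\<close>)
  qed
  have aff: "affine_geodesic (\<lambda>t. \<Lambda> (\<delta> * t))" "affine_geodesic (\<lambda>t. \<Lambda> (N - \<delta> * t))"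
  proof -
    have "\<bar>\<delta> * t\<bar> \<le> \<delta>" "\<bar>N - \<delta> * t\<bar> \<le> \<delta>" if "0 \<le> t" "t \<le> 1" for t
    proof -
      have "0 \<le> \<delta> * t" "\<delta> * t \<le> \<delta>" using that \<delta>(1) by (simp_all add: mult_left_le)
      then show "\<bar>\<delta> * t\<bar> \<le> \<delta>" "\<bar>N - \<delta> * t\<bar> \<le> \<delta>" using N by linarith+
    qed
    then show "affine_geodesic (\<lambda>t. \<Lambda> (\<delta> * t))" "affine_geodesic (\<lambda>t. \<Lambda> (N - \<delta> * t))"
      using \<delta>(1) by (auto intro!: affine_geodesicI[where l = "\<delta> * \<alpha>"]
        simp: \<Lambda>(3) abs_mult abs_minus_commute simp flip: right_diff_distrib)
  qed
  have dists: "dist d1 (\<Lambda> \<delta>) = \<delta> * \<alpha>" "dist c1 (\<Lambda> (N - \<delta>)) = \<delta> * \<alpha>"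
    using \<Lambda>(3)[of 0 \<delta>] \<Lambda>(3)[of N "N - \<delta>"] \<Lambda>(1,2) \<delta>(1) N by auto
  have small: "sqrt \<kappa> * (\<delta> * \<alpha>) \<le> pi / 4"
  proof -
    have "sqrt \<kappa> * (\<delta> * \<alpha>) \<le> sqrt \<kappa> * \<delta>"
      using \<open>\<alpha> \<le> 1\<close> \<delta>(1) \<kappa> by (intro mult_left_mono mult_left_le) auto
    with \<delta>(3) show ?thesis by simp
  qed
  have unit': "dist (a, r) (b, s) = \<delta>" if "dist a b = \<delta> * \<alpha>" "\<bar>r - s\<bar> = \<delta> * \<bar>\<beta>\<bar>" for a b :: 'a and r s
  proof -
    have "(r - s)\<^sup>2 = (\<delta> * \<beta>)\<^sup>2" using that(2) by (metis abs_mult power2_abs power_mult_distrib)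
    then have "(dist (a, r) (b, s))\<^sup>2 = \<delta>\<^sup>2 * (\<alpha>\<^sup>2 + \<beta>\<^sup>2)"
      using that(1) by (simp add: dist_Pair_power2 power_mult_distrib algebra_simps)
    then show ?thesis using unit(2) \<delta>(1) by (simp add: power2_eq_iff_nonneg)
  qed
  show thesis
  proof (rule that[OF unit, of "\<Lambda> \<delta>" "\<Lambda> (N - \<delta>)"])
    show "dist (\<Lambda> \<delta>) (\<Lambda> (N - \<delta>)) = 2 * \<delta> * \<alpha> - dist c1 d1"
      using \<Lambda>(3)[of \<delta> "N - \<delta>"] N \<delta>(1) by (simp add: algebra_simps flip: \<alpha>N)
    show "\<delta> \<le> dist (\<Lambda> \<delta>, d2 + \<delta> * \<beta>) w" if "w \<in> D" for w
    proof (cases "w = (d1, d2)")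
      case True
      then show ?thesis using unit'[of "\<Lambda> \<delta>" d1 "d2 + \<delta> * \<beta>" d2] dists \<delta>(1)
        by (simp add: dist_commute abs_mult)
    next
      case False
      \<comment> \<open>At parameter \<open>N / \<delta>\<close> the segment of length
        \<open>\<delta>\<close> issuing at \<open>(d1, d2)\<close> passes through
        \<open>(c1, c2)\<close>, where local minimality is known.\<close>
      have "dist (\<Lambda> (\<delta> * 1), d2 + \<delta> * \<beta>) (\<Lambda> (\<delta> * 0), d2) < dist (\<Lambda> (\<delta> * 1), d2 + \<delta> * \<beta>) w"
        by (rule local_projection_extends[OF D(1) _ aff(1), where s = "N / \<delta>" and \<epsilon> = \<epsilon>])
          (use D \<Lambda> small dists N \<delta> \<beta>N \<open>0 < \<epsilon>\<close> that False nearest_D in auto)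
      then show ?thesis using unit'[of "\<Lambda> \<delta>" d1 "d2 + \<delta> * \<beta>" d2] dists \<delta>(1) \<Lambda>(1)
        by (simp add: dist_commute abs_mult)
    qed
    show "\<delta> \<le> dist (\<Lambda> (N - \<delta>), c2 - \<delta> * \<beta>) w" if "w \<in> C" for w
    proof (cases "w = (c1, c2)")
      case True
      then show ?thesis using unit'[of "\<Lambda> (N - \<delta>)" c1 "c2 - \<delta> * \<beta>" c2] dists \<delta>(1)
        by (simp add: dist_commute abs_mult)
    next
      case False
      have "dist (\<Lambda> (N - \<delta> * 1), c2 - \<delta> * \<beta>) (\<Lambda> (N - \<delta> * 0), c2) < dist (\<Lambda> (N - \<delta> * 1), c2 - \<delta> * \<beta>) w"
        by (rule local_projection_extends[OF C(1) _ aff(2), where s = "N / \<delta>" and \<epsilon> = \<epsilon>])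
          (use C \<Lambda> small dists N \<delta> \<beta>N \<open>0 < \<epsilon>\<close> that False nearest_C in auto)
      then show ?thesis using unit'[of "\<Lambda> (N - \<delta>)" c1 "c2 - \<delta> * \<beta>" c2] dists \<delta>(1) \<Lambda>(2)
        by (simp add: dist_commute abs_mult)
    qed
  qed (use dists in auto)
qed

end

section \<open>Epigraphs and subgradients\<close>

lemma epi_iff: "(y, a) \<in> epi f \<longleftrightarrow> f y \<le> ereal a"
  by (auto simp: epi_def eff_dom_def intro: le_less_trans)

lemma product_convex_epi:
  assumes "geodesically_convex f"
  shows "product_convex (epi f)"
  unfolding product_convex_def
proof (intro allI impI ballI; elim conjE)
  fix c :: "real \<Rightarrow> 'a" and a b t :: real
  assume c: "affine_geodesic c" and ab: "(c 0, a) \<in> epi f" "(c 1, b) \<in> epi f" and t: "t \<in> {0..1}"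
  obtain \<gamma> where \<gamma>: "geodesic (dist (c 0) (c 1)) \<gamma>" "\<forall>t\<in>{0..1}. \<gamma> (dist (c 0) (c 1) * t) = c t"
    using affine_geodesic_unit_speed[OF c] by blast
  have ends: "\<gamma> 0 = c 0" "\<gamma> (dist (c 0) (c 1)) = c 1"
    using bspec[OF \<gamma>(2), of 0] bspec[OF \<gamma>(2), of 1] by simp_all
  have "f (\<gamma> (dist (c 0) (c 1) * t))
      \<le> ereal (1 - t) * f (\<gamma> 0) + ereal t * f (\<gamma> (dist (c 0) (c 1)))"
    using assms \<gamma>(1) t unfolding geodesically_convex_def by blast
  also have "\<dots> \<le> ereal (1 - t) * ereal a + ereal t * ereal b"
    using ab t unfolding ends epi_iff by (intro add_mono ereal_mult_left_mono) auto
  also have "\<dots> = ereal (a + t * (b - a))" by (simp add: algebra_simps)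
  finally show "(c t, a + t * (b - a)) \<in> epi f" using \<gamma>(2) t by (simp add: epi_iff)
qed

text \<open>Complete sets are closed, and closed sublevel sets mean lower semicontinuity, which is
  closedness of the epigraph. The slack \<open>e\<close> is there because the heights converge to
  \<open>a\<close> but may exceed it.\<close>

lemma closed_epi:
  assumes "complete_sublevel_sets f"
  shows "closed (epi f)"
  unfolding closed_sequential_limits
proof (intro allI impI; elim conjE)
  fix u l assume u: "\<forall>n. u n \<in> epi f" and lim: "u \<longlonglongrightarrow> l"
  obtain y a where l: "l = (y, a)" by (cases l)
  have fst: "(\<lambda>n. fst (u n)) \<longlonglongrightarrow> y" and snd: "(\<lambda>n. snd (u n)) \<longlonglongrightarrow> a"
    using tendsto_fst[OF lim] tendsto_snd[OF lim] l by simp_all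
  have "f y \<le> ereal a + ereal e" if "0 < e" for e
  proof -
    have "closed {y. f y \<le> ereal (a + e)}"
      using assms by (simp add: complete_sublevel_sets_def complete_imp_closed)
    moreover have "eventually (\<lambda>n. fst (u n) \<in> {y. f y \<le> ereal (a + e)}) sequentially"
    proof (rule eventually_mono)
      show "eventually (\<lambda>n. snd (u n) < a + e) sequentially"
        using that by (intro order_tendstoD(2)[OF snd]) simp
      fix n assume "snd (u n) < a + e"
      have "f (fst (u n)) \<le> ereal (snd (u n))" using u epi_iff[of "fst (u n)" "snd (u n)" f] by simp
      also have "\<dots> \<le> ereal (a + e)" using \<open>snd (u n) < a + e\<close> by simp
      finally show "fst (u n) \<in> {y. f y \<le> ereal (a + e)}" by simp
    qed
    ultimately have "y \<in> {y. f y \<le> ereal (a + e)}"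
      using fst by (rule Lim_in_closed_set[OF _ _ sequentially_bot])
    then show ?thesis by simp
  qed
  then have "f y \<le> ereal a" using ereal_le_epsilon2 by blast
  then show "l \<in> epi f" by (simp add: l epi_iff)
qed

lemma tangent_vector_mem_tangent_space:
  assumes "(l, \<gamma>) \<in> geodesics_from x" "0 \<le> r"
  shows "tangent_vector x l \<gamma> r \<in> tangent_space x"
  using assms quotientI[OF assms(1)] unfolding tangent_space_def tangent_vector_def directions_def by blast

context small_CAT
begin

text \<open>For \<open>r = \<alpha> / \<beta>\<close> the curve in the definition of subgradients
  has horizontal speed \<open>\<alpha>\<close> and downward speed \<open>\<beta>\<close>, so at time
  \<open>\<delta>\<close> it reaches the given point. For \<open>\<alpha> = 0\<close> the vector is
  the origin and its geodesic is constant, hence the guards on the last conclusions, which are kept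
  for the angle computation.\<close>

lemma tangent_vector_mem_subdifferential:
  fixes x p :: 'a and f :: "'a \<Rightarrow> ereal"
  assumes f: "geodesically_convex f" and fx: "f x = ereal a"
    and ext: "geodesic_extension_around x R"
    and \<delta>: "0 < \<delta>" "\<delta> < R" "sqrt \<kappa> * \<delta> \<le> pi / 4"
    and unit: "0 \<le> \<alpha>" "0 < \<beta>" "\<alpha>\<^sup>2 + \<beta>\<^sup>2 = 1" and p: "dist x p = \<delta> * \<alpha>"
    and normal: "\<And>w. w \<in> epi f \<Longrightarrow> \<delta> \<le> dist (p, a - \<delta> * \<beta>) w"
  obtains l \<gamma> where "tangent_vector x l \<gamma> (\<alpha> / \<beta>) \<in> subdifferential R f x"
    "0 < \<alpha> \<Longrightarrow> (l, \<gamma>) \<in> geodesics_from x" "0 < \<alpha> \<Longrightarrow> \<delta> * \<alpha> \<le> l" "0 < \<alpha> \<Longrightarrow> \<gamma> (\<delta> * \<alpha>) = p"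
proof -
  have R: "0 < R" using ext by (simp add: geodesic_extension_around_def)
  have "\<alpha>\<^sup>2 \<le> 1" using unit(3) zero_le_power2[of \<beta>] by linarith
  then have "\<alpha> \<le> 1" by (simp add: abs_square_le_1)
  then have \<delta>\<alpha>: "\<delta> * \<alpha> \<le> \<delta>" using \<delta>(1) by (simp add: mult_left_le)
  then have "\<delta> * \<alpha> < R" using \<delta>(2) by simp
  obtain c where c: "affine_geodesic c" "c 0 = x" "c 1 = p" using affine_geodesic_exists .
  obtain \<gamma> where \<gamma>: "geodesic R \<gamma> \<and> 0 < \<alpha> \<or> \<alpha> = 0 \<and> \<gamma> = (\<lambda>_. x)" "\<gamma> 0 = x" "\<gamma> (\<delta> * \<alpha>) = p"
  proof (cases "\<alpha> = 0")
    case True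
    with that[of "\<lambda>_. x"] p show thesis by simp
  next
    case False
    obtain \<gamma> where "geodesic (\<delta> * \<alpha>) \<gamma>" "\<forall>t\<in>{0..1}. \<gamma> (\<delta> * \<alpha> * t) = c t"
      using affine_geodesic_unit_speed[OF c(1)] unfolding c p by blast
    moreover from this have "\<gamma> 0 = x" "\<gamma> (\<delta> * \<alpha>) = p"
      using c by (force dest: bspec[of _ _ 0] bspec[of _ _ 1])+
    moreover have "x \<in> ball x R" "p \<in> ball x R" "x \<noteq> p" "dist x p < R"
      using R \<delta>(1) \<open>\<delta> * \<alpha> < R\<close> p False by auto
    ultimately obtain \<gamma>' where "geodesic R \<gamma>'" "\<forall>t\<in>{0..\<delta> * \<alpha>}. \<gamma>' t = \<gamma> t"
      using ext unfolding geodesic_extension_around_def by metis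
    then show thesis using False unit \<delta>(1) \<open>\<gamma> 0 = x\<close> \<open>\<gamma> (\<delta> * \<alpha>) = p\<close> by (intro that[of \<gamma>']) auto
  qed
  define r where "r = \<alpha> / \<beta>"
  have "r\<^sup>2 + 1 = (1 / \<beta>)\<^sup>2"
    using unit by (simp add: r_def power_divide divide_simps)
  then have sqrt: "sqrt (r\<^sup>2 + 1) = 1 / \<beta>" using unit by (simp add: real_sqrt_divide)
  define \<sigma> where "\<sigma> = graph_geodesic f x \<gamma> r"
  have \<sigma>: "\<sigma> t = (\<gamma> (\<alpha> * t), a - \<beta> * t)" for t
    using unit(2) by (simp add: \<sigma>_def graph_geodesic_def sqrt fx) (simp add: r_def mult.commute)
  have "geodesic R \<sigma>"
    unfolding geodesic_def
  proof (intro conjI ballI)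
    fix s t assume st: "s \<in> {0..R}" "t \<in> {0..R}"
    have "\<alpha> * s \<in> {0..R}" if "s \<in> {0..R}" for s
      using that unit(1) \<open>\<alpha> \<le> 1\<close> mult_mono[of \<alpha> 1 s R] by auto
    then have "dist (\<gamma> (\<alpha> * s)) (\<gamma> (\<alpha> * t)) = \<alpha> * \<bar>s - t\<bar>"
      using \<gamma>(1) st unit(1) by (auto simp: geodesic_def abs_mult simp flip: right_diff_distrib)
    then have "(dist (\<sigma> s) (\<sigma> t))\<^sup>2 = (\<alpha>\<^sup>2 + \<beta>\<^sup>2) * (s - t)\<^sup>2"
      by (simp add: \<sigma> dist_Pair_power2 power_mult_distrib) (simp add: power2_eq_square algebra_simps)
    then have "(dist (\<sigma> s) (\<sigma> t))\<^sup>2 = \<bar>s - t\<bar>\<^sup>2" by (simp add: unit)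
    then show "dist (\<sigma> s) (\<sigma> t) = \<bar>s - t\<bar>" by (rule power2_eq_imp_eq) auto
  qed (use R in simp)
  then have \<sigma>_from: "(R, \<sigma>) \<in> geodesics_from (x, a)"
    using R \<gamma>(2) by (simp add: geodesics_from_def \<sigma>)
  have xa: "(x, a) \<in> epi f" by (simp add: epi_iff fx)
  have \<sigma>\<delta>: "\<sigma> \<delta> = (p, a - \<delta> * \<beta>)" using \<gamma>(3) by (simp add: \<sigma> mult.commute)
  have d0: "dist (p, a - \<delta> * \<beta>) (x, a) = \<delta>"
  proof -
    have "(dist (p, a - \<delta> * \<beta>) (x, a))\<^sup>2 = \<delta>\<^sup>2 * (\<alpha>\<^sup>2 + \<beta>\<^sup>2)"
      using p by (simp add: dist_Pair_power2 dist_commute power_mult_distrib algebra_simps)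
    then show ?thesis using unit(3) \<delta>(1) by (simp add: power2_eq_iff_nonneg)
  qed
  \<comment> \<open>By hypothesis \<open>(x, a)\<close> is a nearest point, while the normal cone
    asks for the only one; prolongation with \<open>s = 1\<close> supplies the difference.\<close>
  have strict: "\<delta> < dist (p, a - \<delta> * \<beta>) w" if "w \<in> epi f" "w \<noteq> (x, a)" for w
  proof -
    have "sqrt \<kappa> * (\<delta> * \<alpha>) \<le> sqrt \<kappa> * \<delta>" using \<delta>\<alpha> \<kappa> by (intro mult_left_mono) auto
    then have "dist (c 1, a - \<delta> * \<beta>) (c 0, a) < dist (c 1, a - \<delta> * \<beta>) w"
      by (intro local_projection_extends[OF product_convex_epi[OF f] _ c(1), where s = 1 and \<epsilon> = 1])
        (use c p \<delta>(3) xa that normal d0 in auto)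
    then show ?thesis using c d0 by simp
  qed
  have "infdist (\<sigma> \<delta>) (epi f) = \<delta>"
  proof (rule antisym)
    show "infdist (\<sigma> \<delta>) (epi f) \<le> \<delta>" using infdist_le[OF xa, of "\<sigma> \<delta>"] by (simp add: \<sigma>\<delta> d0)
    show "\<delta> \<le> infdist (\<sigma> \<delta>) (epi f)"
      using xa normal by (auto simp: infdist_def \<sigma>\<delta> intro!: cINF_greatest)
  qed
  then have "metric_proj (epi f) (\<sigma> \<delta>) = {(x, a)}"
    using xa strict d0 by (fastforce simp: metric_proj_def \<sigma>\<delta>)
  moreover have "tangent_vector (x, a) R \<sigma> 1 \<in> tangent_space (x, a)"
    using \<sigma>_from by (simp add: tangent_vector_mem_tangent_space)
  ultimately have "tangent_vector (x, a) R \<sigma> 1 \<in> normal_cone (epi f) (x, a)"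
    using \<sigma>_from \<delta>(1,2) unfolding normal_cone_def mem_Collect_eq
    by (metis less_eq_real_def)
  moreover have "0 \<le> r" using unit by (simp add: r_def)
  moreover have \<gamma>_from: "(R, \<gamma>) \<in> geodesics_from x \<and> R \<le> R \<or> r = 0 \<and> \<gamma> = (\<lambda>_. x)"
    using \<gamma> R by (auto simp: geodesics_from_def r_def)
  moreover have "tangent_vector x R \<gamma> r \<in> tangent_space x"
    using \<gamma>_from \<open>0 \<le> r\<close>
    by (auto simp: tangent_vector_mem_tangent_space) (simp add: tangent_vector_def cone_point_def tangent_space_def)
  ultimately have "tangent_vector x R \<gamma> r \<in> subdifferential R f x"
    unfolding subdifferential_def mem_Collect_eq fx real_of_ereal.simps
    by (intro conjI exI[of _ R] exI[of _ \<gamma>] exI[of _ r]) (auto simp: \<sigma>_def fx)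
  then show thesis
    using \<gamma> R \<open>\<delta> * \<alpha> < R\<close> by (intro that[of R \<gamma>]) (auto simp: r_def geodesics_from_def)
qed

end

section \<open>Alexandrov angles read off from distances\<close>

lemma alexandrov_angle_eqI:
  assumes "0 < \<epsilon>"
    and "\<And>s t. 0 < s \<Longrightarrow> s < \<epsilon> \<Longrightarrow> 0 < t \<Longrightarrow> t < \<epsilon> \<Longrightarrow> comparison_angle \<gamma> \<eta> s t = \<theta>"
  shows "alexandrov_angle \<gamma> \<eta> = \<theta>"
proof -
  let ?F = "at_right 0 \<times>\<^sub>F at_right (0::real) :: (real \<times> real) filter"
  have "eventually (\<lambda>s. 0 < s \<and> s < \<epsilon>) (at_right 0)"
    using assms(1) by (auto simp: eventually_at_right_field)
  then have "eventually (\<lambda>(s, t). (0 < s \<and> s < \<epsilon>) \<and> 0 < t \<and> t < \<epsilon>) ?F"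
    using eventually_prodI[of "\<lambda>s. 0 < s \<and> s < \<epsilon>" "at_right 0" "\<lambda>t. 0 < t \<and> t < \<epsilon>" "at_right 0"]
    by (simp add: case_prod_unfold)
  then have "eventually (\<lambda>u. (case u of (s, t) \<Rightarrow> ereal (comparison_angle \<gamma> \<eta> s t)) = ereal \<theta>) ?F"
    by (rule eventually_mono) (auto simp: assms(2))
  then have "Limsup ?F (\<lambda>(s, t). ereal (comparison_angle \<gamma> \<eta> s t)) = Limsup ?F (\<lambda>_. ereal \<theta>)"
    by (rule Limsup_eq)
  also have "\<dots> = ereal \<theta>" by (rule Limsup_const) (simp add: prod_filter_eq_bot)
  finally show ?thesis by (simp add: alexandrov_angle_def)
qed

text \<open>\<open>opposite\<close> asks for representatives of two classes; reflexivity lets the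
  constructed geodesics serve.\<close>

lemma same_direction_refl:
  assumes "(l, \<gamma>) \<in> geodesics_from x"
  shows "(l, \<gamma>) \<in> same_direction x `` {(l, \<gamma>)}"
proof -
  have l: "0 < l" "geodesic l \<gamma>" using assms by (auto simp: geodesics_from_def)
  have "alexandrov_angle \<gamma> \<gamma> = 0"
  proof (rule alexandrov_angle_eqI[OF l(1)])
    fix s t assume "0 < s" "s < l" "0 < t" "t < l"
    moreover from this have "dist (\<gamma> s) (\<gamma> t) = \<bar>s - t\<bar>" using l by (auto simp: geodesic_def)
    ultimately show "comparison_angle \<gamma> \<gamma> s t = 0"
      by (simp add: comparison_angle_def power2_eq_square algebra_simps)
  qed
  with assms show ?thesis by (simp add: same_direction_def)
qed

text \<open>The two curves joined at their start realise the distance of their ends, so the triangle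
  inequality forces \<open>dist (\<gamma> s) (\<eta> t) = s + t\<close> at all earlier times, and
  every comparison angle is \<open>arccos (- 1)\<close>.\<close>

lemma alexandrov_angle_eq_pi:
  fixes \<gamma> \<eta> :: "real \<Rightarrow> 'a::metric_space"
  assumes \<gamma>: "geodesic l \<gamma>" and \<eta>: "geodesic m \<eta>" and "\<gamma> 0 = \<eta> 0"
    and a: "0 < a" "a \<le> l" "a \<le> m" and ends: "dist (\<gamma> a) (\<eta> a) = 2 * a"
  shows "alexandrov_angle \<gamma> \<eta> = pi"
proof (rule alexandrov_angle_eqI[OF a(1)])
  fix s t assume st: "0 < s" "s < a" "0 < t" "t < a"
  have "dist (\<gamma> s) (\<gamma> 0) = s" "dist (\<gamma> a) (\<gamma> s) = a - s" "dist (\<eta> 0) (\<eta> t) = t" "dist (\<eta> t) (\<eta> a) = a - t"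
    using \<gamma> \<eta> a st by (auto simp: geodesic_def)
  then have "dist (\<gamma> s) (\<eta> t) = s + t"
    using ends dist_triangle[of "\<gamma> s" "\<eta> t" "\<gamma> 0"] dist_triangle[of "\<gamma> a" "\<eta> a" "\<gamma> s"]
      dist_triangle[of "\<gamma> s" "\<eta> a" "\<eta> t"] \<open>\<gamma> 0 = \<eta> 0\<close> by simp
  moreover have "(s\<^sup>2 + t\<^sup>2 - (s + t)\<^sup>2) / (2 * s * t) = - 1"
    using st by (simp add: power2_eq_square field_simps)
  ultimately show "comparison_angle \<gamma> \<eta> s t = pi" by (simp add: comparison_angle_def)
qed

section \<open>Opposite normal vectors at a contact point\<close>

text \<open>Compactness gives a nearest pair in \<open>K\<close> after raising \<open>E\<close> by
  \<open>\<epsilon>\<close>, and the competitors \<open>(x, a + \<epsilon>)\<close> and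
  \<open>(x, a)\<close> bound its distance by \<open>\<epsilon>\<close>. As the shift vanishes,
  limits of such pairs lie in both sets, hence equal \<open>(x, a)\<close>.\<close>

lemma shifted_nearest_pairs:
  fixes E D K :: "('a::metric_space \<times> real) set"
  assumes closed: "closed E" "closed D" and K: "compact K"
    and y: "(x, a) \<in> E" "(x, a) \<in> D" "E \<inter> D \<inter> K \<subseteq> {(x, a)}"
    and up: "\<And>\<epsilon>. 0 \<le> \<epsilon> \<Longrightarrow> \<epsilon> \<le> 1 \<Longrightarrow> (x, a + \<epsilon>) \<in> K" and \<eta>: "0 < \<eta>"
  obtains \<epsilon> c d where "0 < \<epsilon>" "\<epsilon> \<le> \<eta>" "(fst c, snd c - \<epsilon>) \<in> E" "d \<in> D" "dist c d \<le> \<epsilon>"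
    "dist c (x, a) < \<eta>" "dist d (x, a) < \<eta>"
    "\<And>c' d'. c' \<in> K \<Longrightarrow> d' \<in> K \<Longrightarrow> (fst c', snd c' - \<epsilon>) \<in> E \<Longrightarrow> d' \<in> D \<Longrightarrow> dist c d \<le> dist c' d'"
proof -
  define \<epsilon> where "\<epsilon> n = min 1 \<eta> / real (Suc n)" for n
  have \<epsilon>: "0 < \<epsilon> n" "\<epsilon> n \<le> 1" "\<epsilon> n \<le> \<eta>" for n
  proof -
    have "min 1 \<eta> / real (Suc n) \<le> min 1 \<eta> / 1" using \<eta> by (intro divide_left_mono) auto
    then show "0 < \<epsilon> n" "\<epsilon> n \<le> 1" "\<epsilon> n \<le> \<eta>" using \<eta> by (auto simp: \<epsilon>_def)
  qed
  have \<epsilon>0: "\<epsilon> \<longlonglongrightarrow> 0" unfolding \<epsilon>_def by (rule lim_const_over_n[THEN LIMSEQ_Suc])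
  define C where "C n = {v. (fst v, snd v - \<epsilon> n) \<in> E}" for n
  have "\<exists>c d. c \<in> C n \<inter> K \<and> d \<in> D \<inter> K \<and> (\<forall>c'\<in>C n \<inter> K. \<forall>d'\<in>D \<inter> K. dist c d \<le> dist c' d')" for n
  proof -
    have "closed (C n)"
    proof -
      have "C n = (\<lambda>v. (fst v, snd v - \<epsilon> n)) -` E" by (auto simp: C_def)
      then show ?thesis using closed(1) by (auto intro!: closed_vimage continuous_intros)
    qed
    then have "compact ((C n \<inter> K) \<times> (D \<inter> K))"
      using closed K by (intro compact_Times closed_Int_compact) auto
    moreover have "((x, a + \<epsilon> n), (x, a)) \<in> (C n \<inter> K) \<times> (D \<inter> K)"
      using y up[of 0] up[of "\<epsilon> n"] \<epsilon>[of n] by (auto simp: C_def)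
    ultimately obtain z where z: "z \<in> (C n \<inter> K) \<times> (D \<inter> K)"
      "\<forall>z'\<in>(C n \<inter> K) \<times> (D \<inter> K). dist (fst z) (snd z) \<le> dist (fst z') (snd z')"
      using continuous_attains_inf[of "(C n \<inter> K) \<times> (D \<inter> K)" "\<lambda>z. dist (fst z) (snd z)"]
      by (fastforce intro!: continuous_intros)
    then show ?thesis by (intro exI[of _ "fst z"] exI[of _ "snd z"]) auto
  qed
  then obtain c d where cd: "\<And>n. c n \<in> C n \<inter> K" "\<And>n. d n \<in> D \<inter> K"
    "\<And>n c' d'. c' \<in> C n \<inter> K \<Longrightarrow> d' \<in> D \<inter> K \<Longrightarrow> dist (c n) (d n) \<le> dist c' d'"
    by metis
  have le: "dist (c n) (d n) \<le> \<epsilon> n" for n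
  proof -
    have "dist (c n) (d n) \<le> dist (x, a + \<epsilon> n) (x, a)"
      using y up[of 0] up[of "\<epsilon> n"] \<epsilon>[of n] by (intro cd(3)) (auto simp: C_def)
    also have "\<dots> = \<epsilon> n" using \<epsilon>(1)[of n] by (simp add: dist_Pair_Pair dist_real_def)
    finally show ?thesis .
  qed
  obtain l r where r: "strict_mono (r :: nat \<Rightarrow> nat)" "(c \<circ> r) \<longlonglongrightarrow> l" and l: "l \<in> K"
    using K cd(1) unfolding compact_eq_seq_compact_metric seq_compact_def by (metis IntD2)
  have \<epsilon>r: "(\<lambda>n. \<epsilon> (r n)) \<longlonglongrightarrow> 0" using LIMSEQ_subseq_LIMSEQ[OF \<epsilon>0 r(1)] by (simp add: o_def)
  have cr: "(\<lambda>n. c (r n)) \<longlonglongrightarrow> l" using r(2) by (simp add: o_def)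
  have "(\<lambda>n. dist (c (r n)) (d (r n))) \<longlonglongrightarrow> 0"
    by (rule tendsto_sandwich[OF _ _ tendsto_const \<epsilon>r]) (simp_all add: le)
  from tendsto_add[OF this iffD1[OF tendsto_dist_iff cr]]
  have lim: "(\<lambda>n. dist (c (r n)) (d (r n)) + dist (c (r n)) l) \<longlonglongrightarrow> 0" by simp
  have "(\<lambda>n. dist (d (r n)) l) \<longlonglongrightarrow> 0"
    by (rule tendsto_sandwich[OF _ _ tendsto_const lim]) (simp_all add: dist_triangle3)
  then have dr: "(\<lambda>n. d (r n)) \<longlonglongrightarrow> l" by (simp add: tendsto_dist_iff[of _ l])
  have "l \<in> D" using cd(2) by (intro closed_sequentially[OF closed(2) _ dr]) auto
  moreover have "l \<in> E"
  proof (rule closed_sequentially[OF closed(1)])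
    show "(fst (c (r n)), snd (c (r n)) - \<epsilon> (r n)) \<in> E" for n using cd(1)[of "r n"] by (simp add: C_def)
    have "(\<lambda>n. (fst (c (r n)), snd (c (r n)) - \<epsilon> (r n))) \<longlonglongrightarrow> (fst l, snd l - 0)"
      by (intro tendsto_intros cr \<epsilon>r)
    then show "(\<lambda>n. (fst (c (r n)), snd (c (r n)) - \<epsilon> (r n))) \<longlonglongrightarrow> l" by simp
  qed
  ultimately have "l = (x, a)" using l y(3) by auto
  then have "eventually (\<lambda>n. dist (c (r n)) (x, a) < \<eta>) sequentially"
    "eventually (\<lambda>n. dist (d (r n)) (x, a) < \<eta>) sequentially"
    using tendstoD[OF cr \<eta>] tendstoD[OF dr \<eta>] by simp_all
  then have "eventually (\<lambda>n. dist (c (r n)) (x, a) < \<eta> \<and> dist (d (r n)) (x, a) < \<eta>) sequentially"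
    by (rule eventually_conj)
  then obtain n where "dist (c (r n)) (x, a) < \<eta>" "dist (d (r n)) (x, a) < \<eta>"
    by (auto simp: eventually_sequentially)
  then show thesis
    using cd(1,2)[of "r n"] cd(3)[where n = "r n"] \<epsilon>[of "r n"] le[of "r n"] by (intro that[of "\<epsilon> (r n)" "c (r n)" "d (r n)"]) (auto simp: C_def)
qed

context small_CAT
begin

text \<open>The raised set is disjoint from \<open>D\<close>, so the nearest pair spans a direction.
  Since the pair is close to the centre of \<open>K\<close>, minimality within \<open>K\<close> is
  local minimality in the whole product, which suffices for prolongation.\<close>

lemma approximate_opposite_normals:
  fixes x :: 'a
  assumes ext: "geodesic_extension_around x R"
    and E: "product_convex E" "closed E" "(x, a) \<in> E"
    and D: "product_convex D" "closed D" "(x, a) \<in> D" "E \<inter> D \<subseteq> {(x, a)}"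
    and below: "\<And>u s t. (u, s) \<in> E \<Longrightarrow> (u, t) \<in> D \<Longrightarrow> t \<le> s"
    and \<rho>: "compact (cball x \<rho>)" "\<rho> \<le> 1"
    and \<delta>: "0 < \<delta>" "\<delta> \<le> R / 4" "sqrt \<kappa> * \<delta> \<le> pi / 4"
    and \<eta>: "0 < \<eta>" "\<eta> < \<rho>" "\<eta> \<le> \<delta>"
  obtains c d p q \<alpha> \<beta> \<epsilon> where "0 < \<epsilon>" "\<epsilon> \<le> \<eta>" "dist c (x, a) < \<eta>" "dist d (x, a) < \<eta>"
    "0 \<le> \<alpha>" "\<alpha>\<^sup>2 + \<beta>\<^sup>2 = 1" "dist (fst d) p = \<delta> * \<alpha>" "dist (fst c) q = \<delta> * \<alpha>"
    "dist p q = 2 * \<delta> * \<alpha> - dist (fst c) (fst d)"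
    "\<And>w. w \<in> D \<Longrightarrow> \<delta> \<le> dist (p, snd d + \<delta> * \<beta>) w"
    "\<And>u s. (u, s) \<in> E \<Longrightarrow> \<delta> \<le> dist (q, snd c - \<delta> * \<beta>) (u, s + \<epsilon>)"
proof -
  define K where "K = cball x \<rho> \<times> cball a 1"
  have up: "(x, a + \<epsilon>) \<in> K" if "0 \<le> \<epsilon>" "\<epsilon> \<le> 1" for \<epsilon>
    using that \<eta> by (simp add: K_def dist_real_def)
  have K: "v \<in> K" if "dist v (x, a) \<le> \<rho>" for v
    using that \<rho>(2) dist_fst_le[of "(x, a)" v] dist_snd_le[of "(x, a)" v]
    by (cases v) (simp add: K_def dist_commute)
  have "compact K" unfolding K_def using \<rho>(1) by (intro compact_Times) auto
  from shifted_nearest_pairs[OF E(2) D(2) this E(3) D(3) _ up \<eta>(1)] D(4)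
  obtain \<epsilon> c d where \<epsilon>: "0 < \<epsilon>" "\<epsilon> \<le> \<eta>" and cE: "(fst c, snd c - \<epsilon>) \<in> E" and "d \<in> D"
    and dist: "dist c d \<le> \<epsilon>" "dist c (x, a) < \<eta>" "dist d (x, a) < \<eta>"
    and min: "\<And>c' d'. c' \<in> K \<Longrightarrow> d' \<in> K \<Longrightarrow> (fst c', snd c' - \<epsilon>) \<in> E \<Longrightarrow> d' \<in> D \<Longrightarrow> dist c d \<le> dist c' d'"
    by blast
  define C where "C = {v. (fst v, snd v - \<epsilon>) \<in> E}"
  have C: "product_convex C"
    unfolding product_convex_def
  proof (intro allI impI ballI; elim conjE)
    fix e :: "real \<Rightarrow> 'a" and r s t :: real
    assume "affine_geodesic e" "(e 0, r) \<in> C" "(e 1, s) \<in> C" "t \<in> {0..1}"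
    then have "(e t, (r - \<epsilon>) + t * ((s - \<epsilon>) - (r - \<epsilon>))) \<in> E"
      using E(1) by (intro product_convexD) (auto simp: C_def)
    then show "(e t, r + t * (s - r)) \<in> C" by (simp add: C_def algebra_simps)
  qed
  obtain c1 c2 d1 d2 where [simp]: "c = (c1, c2)" "d = (d1, d2)" by (cases c, cases d)
  have "(c1, c2) \<noteq> (d1, d2)" using below[of c1 "c2 - \<epsilon>" c2] cE \<open>d \<in> D\<close> \<epsilon>(1) by auto
  have ball: "c1 \<in> ball x (R / 4)" "d1 \<in> ball x (R / 4)"
    using dist(2,3) dist_fst_le[of c "(x, a)"] dist_fst_le[of d "(x, a)"] \<eta> \<delta> by (auto simp: dist_commute)
  have "c \<in> K" "d \<in> K" using dist \<eta> by (auto intro!: K)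
  \<comment> \<open>Points within \<open>\<rho> - \<eta>\<close> of \<open>c\<close> are within
    \<open>\<rho>\<close> of \<open>(x, a)\<close> and therefore belong to \<open>K\<close>.\<close>
  have nearest_C: "dist (d1, d2) (c1, c2) \<le> dist (d1, d2) v" if "v \<in> C" "dist v (c1, c2) < \<rho> - \<eta>" for v
  proof -
    have "v \<in> K" using that dist(2) dist_triangle[of v "(x, a)" c] by (intro K) simp
    with that \<open>d \<in> K\<close> \<open>d \<in> D\<close> min[of v d] show ?thesis by (simp add: C_def dist_commute)
  qed
  have nearest_D: "dist (c1, c2) (d1, d2) \<le> dist (c1, c2) v" if "v \<in> D" "dist v (d1, d2) < \<rho> - \<eta>" for v
  proof -
    have "v \<in> K" using that dist(3) dist_triangle[of v "(x, a)" d] by (intro K) simp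
    with that \<open>c \<in> K\<close> cE min[of c v] show ?thesis by simp
  qed
  have "(c1, c2) \<in> C" "(d1, d2) \<in> D" "dist (c1, c2) (d1, d2) \<le> \<delta>" "0 < \<rho> - \<eta>"
    using cE \<open>d \<in> D\<close> \<epsilon> dist \<eta> by (auto simp: C_def)
  then obtain p q \<alpha> \<beta> where "0 \<le> \<alpha>" "\<alpha>\<^sup>2 + \<beta>\<^sup>2 = 1" "dist d1 p = \<delta> * \<alpha>" "dist c1 q = \<delta> * \<alpha>"
    "dist p q = 2 * \<delta> * \<alpha> - dist c1 d1"
    "\<And>w. w \<in> D \<Longrightarrow> \<delta> \<le> dist (p, d2 + \<delta> * \<beta>) w" "\<And>w. w \<in> C \<Longrightarrow> \<delta> \<le> dist (q, c2 - \<delta> * \<beta>) w"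
    using nearest_C nearest_D
    by (elim opposite_normals[OF ext C _ D(1) _ ball \<delta> \<open>(c1, c2) \<noteq> (d1, d2)\<close>]) blast+
  then show thesis
    using \<epsilon> dist by (intro that[of \<epsilon> c d \<alpha> \<beta> p q]) (auto simp: C_def)
qed

text \<open>Here the continuity of \<open>f\<close> enters: \<open>epi f\<close> has no horizontal normal vectors.\<close>

lemma normal_not_horizontal:
  fixes x q :: 'a
  assumes E: "product_convex E" "(x, a) \<in> E" and bound: "0 < \<theta>" "\<And>u. dist x u < \<theta> \<Longrightarrow> (u, a + 1) \<in> E"
    and \<delta>: "0 < \<delta>" and unit: "0 \<le> \<alpha>" "\<alpha>\<^sup>2 + \<beta>\<^sup>2 = 1" and q: "dist x q = \<delta> * \<alpha>"
    and normal: "\<And>w. w \<in> E \<Longrightarrow> \<delta> \<le> dist (q, a - \<delta> * \<beta>) w"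
  shows "0 < \<beta>"
proof (rule ccontr)
  assume "\<not> 0 < \<beta>"
  obtain e where e: "affine_geodesic e" "e 0 = x" "e 1 = q" using affine_geodesic_exists .
  \<comment> \<open>Small enough to bring \<open>e t\<close> within \<open>\<theta>\<close> of
    \<open>x\<close>; the summand 1 covers \<open>\<alpha> = 0\<close>.\<close>
  define t where "t = min 1 (\<theta> / (2 * (\<delta> * \<alpha> + 1)))"
  have \<delta>\<alpha>: "0 \<le> \<delta> * \<alpha>" using \<delta> unit by simp
  have t: "0 < t" "t \<le> 1" using bound(1) \<delta>\<alpha> by (auto simp: t_def)
  have "\<delta> * \<alpha> * t < \<theta>"
  proof -
    have "\<delta> * \<alpha> * t \<le> (\<delta> * \<alpha> + 1) * (\<theta> / (2 * (\<delta> * \<alpha> + 1)))"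
      using \<delta>\<alpha> t by (intro mult_mono) (auto simp: t_def)
    also have "\<dots> = \<theta> / 2" using \<delta>\<alpha> by (simp add: field_simps)
    finally show ?thesis using bound(1) by simp
  qed
  moreover have "dist x (e t) = \<delta> * \<alpha> * t" using affine_geodesicD[OF e(1), of 0 t] t e q by simp
  ultimately have et: "(e t, a + 1) \<in> E" by (intro bound(2)) simp
  have aff: "affine_geodesic (\<lambda>s. e (t * s))"
  proof (rule affine_geodesicI)
    fix r s :: real assume rs: "0 \<le> r" "r \<le> 1" "0 \<le> s" "s \<le> 1"
    have "0 \<le> t * r" "t * r \<le> 1" "0 \<le> t * s" "t * s \<le> 1" using rs t by (auto intro: mult_le_one)
    from affine_geodesicD[OF e(1) this] show "dist (e (t * r)) (e (t * s)) = dist (e 0) (e 1) * t * \<bar>r - s\<bar>"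
      using t by (simp add: abs_mult flip: right_diff_distrib)
  qed
  \<comment> \<open>Along the segment from \<open>(x, a)\<close> to \<open>(e t, a + 1)\<close> the
    squared distance to the normal point is \<open>\<delta>\<^sup>2 + s * (s * A - B)\<close>. If
    \<open>\<beta>\<close> is not positive, then \<open>B\<close> is, and the distance drops below
    \<open>\<delta>\<close> for small \<open>s\<close>.\<close>
  define A where "A = (\<delta> * \<alpha> * t)\<^sup>2 + 1"
  define B where "B = 2 * (\<delta> * \<alpha>)\<^sup>2 * t - 2 * \<delta> * \<beta>"
  have "0 < A" by (simp add: A_def add_nonneg_pos)
  have "0 < B"
  proof (cases "\<alpha> = 0")
    case True
    then have "\<beta> < 0" using unit \<open>\<not> 0 < \<beta>\<close> by (cases "\<beta> = 0") auto
    with True \<delta> show ?thesis by (simp add: B_def mult_pos_neg)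
  next
    case False
    then have "0 < 2 * (\<delta> * \<alpha>)\<^sup>2 * t" using \<delta> t by simp
    moreover have "2 * \<delta> * \<beta> \<le> 0" using \<delta> \<open>\<not> 0 < \<beta>\<close> by (simp add: mult_nonneg_nonpos)
    ultimately show ?thesis unfolding B_def by linarith
  qed
  define s where "s = min 1 (B / (2 * A))"
  have s: "0 < s" "s \<le> 1" using \<open>0 < A\<close> \<open>0 < B\<close> by (auto simp: s_def)
  have "s * A \<le> B / (2 * A) * A" using \<open>0 < A\<close> by (intro mult_right_mono) (auto simp: s_def)
  then have "s * A < B" using \<open>0 < A\<close> \<open>0 < B\<close> by simp
  have "(e (t * s), a + s * ((a + 1) - a)) \<in> E"
    using E(2) et e s by (intro product_convexD[OF E(1) aff]) auto
  then have "\<delta>\<^sup>2 \<le> (dist (q, a - \<delta> * \<beta>) (e (t * s), a + s))\<^sup>2"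
    using normal \<delta> by (intro power_mono) auto
  also have "\<dots> = (\<delta> * \<alpha> * (1 - t * s))\<^sup>2 + (\<delta> * \<beta> + s)\<^sup>2"
  proof -
    have "t * s \<le> 1" "0 \<le> t * s" using t s by (auto intro: mult_le_one)
    then have "dist q (e (t * s)) = \<delta> * \<alpha> * (1 - t * s)"
      using affine_geodesicD[OF e(1), of 1 "t * s"] e q by simp
    moreover have "(a - \<delta> * \<beta> - (a + s))\<^sup>2 = (\<delta> * \<beta> + s)\<^sup>2" by (simp add: power2_eq_square algebra_simps)
    ultimately show ?thesis by (simp add: dist_Pair_power2)
  qed
  also have "\<dots> = \<delta>\<^sup>2 * (\<alpha>\<^sup>2 + \<beta>\<^sup>2) + s * (s * A - B)"
    by (simp add: A_def B_def power2_eq_square algebra_simps)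
  also have "\<dots> < \<delta>\<^sup>2" using unit s \<open>s * A < B\<close> by (simp add: mult_pos_neg)
  finally show False by simp
qed


text \<open>The perturbation by \<open>\<psi>\<close> makes the contact point unique, so that nearest pairs converge to it;
  \<open>1 - cos\<close> of the distance is used because its convexity is immediate from the hinge inequality.\<close>

lemma opposite_normals_at_contact:
  fixes x :: 'a
  assumes ext: "geodesic_extension_around x R"
    and E: "product_convex E" "closed E" "(x, a) \<in> E"
    and upward: "\<And>u s t. (u, s) \<in> E \<Longrightarrow> s \<le> t \<Longrightarrow> (u, t) \<in> E"
    and D: "product_convex D" "closed D" "(x, a) \<in> D"
    and below: "\<And>u s t. (u, s) \<in> E \<Longrightarrow> (u, t) \<in> D \<Longrightarrow> t \<le> s"
    and contact: "\<And>s. (x, s) \<in> E \<Longrightarrow> (x, s) \<in> D \<Longrightarrow> s = a"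
    and \<rho>: "compact (cball x \<rho>)" "\<rho> \<le> 1"
    and \<delta>: "0 < \<delta>" "\<delta> \<le> R / 4" "2 * \<delta> \<le> \<rho>" "sqrt \<kappa> * \<delta> \<le> pi / 4"
  obtains p q \<alpha> \<beta> where "0 \<le> \<alpha>" "\<alpha>\<^sup>2 + \<beta>\<^sup>2 = 1" "dist x p = \<delta> * \<alpha>" "dist x q = \<delta> * \<alpha>"
    "dist p q = 2 * \<delta> * \<alpha>"
    "\<And>w. w \<in> D \<Longrightarrow> \<delta> \<le> dist (p, a + \<delta> * \<beta>) w" "\<And>w. w \<in> E \<Longrightarrow> \<delta> \<le> dist (q, a - \<delta> * \<beta>) w"
proof -
  define k where "k = sqrt \<kappa>"
  have k: "0 < k" using \<kappa> by (simp add: k_def)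
  define \<psi> where "\<psi> u = 1 - cos (k * dist x u)" for u :: 'a
  have \<psi>_nonneg: "0 \<le> \<psi> u" for u by (simp add: \<psi>_def)
  have \<psi>_zero: "u = x" if "\<psi> u \<le> 0" for u
  proof (rule ccontr)
    assume "u \<noteq> x"
    then have "0 < k * dist x u" "k * dist x u < pi / 2" using k scaled_dist_less by (auto simp: k_def)
    then have "cos (k * dist x u) < cos 0" using pi_gt_zero by (intro cos_monotone_0_pi) linarith+
    with that show False by (simp add: \<psi>_def)
  qed
  \<comment> \<open>\<open>E\<close> is raised by a multiple of \<open>\<psi>\<close>, which leaves
    the fibre over \<open>x\<close> unchanged; the factor tends to 0, so points of \<open>E\<close>
    are limits of points of the sets \<open>F n\<close>.\<close>
  define F where "F n = {v. (fst v, snd v - \<psi> (fst v) / Suc n) \<in> E}" for n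
  define \<eta> where "\<eta> n = \<delta> / Suc n" for n
  have \<eta>: "0 < \<eta> n" "\<eta> n \<le> \<delta>" for n using \<delta>(1) by (auto simp: \<eta>_def divide_le_eq mult_left_le)
  have \<eta>0: "\<eta> \<longlonglongrightarrow> 0" unfolding \<eta>_def by (rule lim_const_over_n[THEN LIMSEQ_Suc])
  define P where "P n c d p q \<alpha> \<beta> \<epsilon> \<longleftrightarrow> 0 < \<epsilon> \<and> \<epsilon> \<le> \<eta> n \<and> dist c (x, a) < \<eta> n \<and> dist d (x, a) < \<eta> n \<and>
      0 \<le> \<alpha> \<and> \<alpha>\<^sup>2 + \<beta>\<^sup>2 = 1 \<and> dist (fst d) p = \<delta> * \<alpha> \<and> dist (fst c) q = \<delta> * \<alpha> \<and>
      dist p q = 2 * \<delta> * \<alpha> - dist (fst c) (fst d) \<and>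
      (\<forall>w\<in>D. \<delta> \<le> dist (p, snd d + \<delta> * \<beta>) w) \<and>
      (\<forall>u s. (u, s) \<in> F n \<longrightarrow> \<delta> \<le> dist (q, snd c - \<delta> * \<beta>) (u, s + \<epsilon>))" for n c d p q \<alpha> \<beta> \<epsilon>
  have "\<exists>c d p q \<alpha> \<beta> \<epsilon>. P n c d p q \<alpha> \<beta> \<epsilon>" for n
  proof -
    have Fn: "product_convex (F n)"
      unfolding product_convex_def
    proof (intro allI impI ballI; elim conjE)
      fix e :: "real \<Rightarrow> 'a" and r s t :: real
      assume e: "affine_geodesic e" and rs: "(e 0, r) \<in> F n" "(e 1, s) \<in> F n" and t: "t \<in> {0..1}"
      let ?r = "r - \<psi> (e 0) / Suc n" and ?s = "s - \<psi> (e 1) / Suc n"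
      have "(e t, ?r + t * (?s - ?r)) \<in> E"
        using rs t by (intro product_convexD[OF E(1) e]) (auto simp: F_def)
      moreover have "\<psi> (e t) \<le> \<psi> (e 0) + t * (\<psi> (e 1) - \<psi> (e 0))"
        using cos_dist_concave[OF e, of t x] t by (simp add: \<psi>_def k_def algebra_simps)
      then have "\<psi> (e t) / Suc n \<le> (\<psi> (e 0) + t * (\<psi> (e 1) - \<psi> (e 0))) / Suc n"
        by (rule divide_right_mono) simp
      then have "?r + t * (?s - ?r) \<le> r + t * (s - r) - \<psi> (e t) / Suc n"
        by (simp add: algebra_simps add_divide_distrib diff_divide_distrib)
      ultimately show "(e t, r + t * (s - r)) \<in> F n" using upward by (simp add: F_def)
    qed
    have closed: "closed (F n)"
    proof -
      have "F n = (\<lambda>v. (fst v, snd v - \<psi> (fst v) / Suc n)) -` E" by (auto simp: F_def)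
      then show ?thesis using E(2) by (auto simp: \<psi>_def intro!: closed_vimage continuous_intros)
    qed
    have xaF: "(x, a) \<in> F n" using E(3) by (simp add: F_def \<psi>_def)
    have FD: "F n \<inter> D \<subseteq> {(x, a)}"
    proof
      fix v assume v: "v \<in> F n \<inter> D"
      then have vE: "(fst v, snd v - \<psi> (fst v) / Suc n) \<in> E" by (simp add: F_def)
      then have "snd v \<le> snd v - \<psi> (fst v) / Suc n" using v by (intro below) auto
      then have "fst v = x" by (intro \<psi>_zero) (simp add: divide_le_0_iff)
      then show "v \<in> {(x, a)}" using vE v contact[of "snd v"] by (cases v) (auto simp: \<psi>_def)
    qed
    have below_Fn: "t \<le> s" if "(u, s) \<in> F n" "(u, t) \<in> D" for u s t
    proof -
      have "t \<le> s - \<psi> u / Suc n" using that by (intro below) (auto simp: F_def)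
      moreover have "0 \<le> \<psi> u / Suc n" using \<psi>_nonneg by simp
      ultimately show ?thesis by linarith
    qed
    have "\<eta> n < \<rho>" using \<eta>(2)[of n] \<delta> by simp
    show ?thesis
      by (rule approximate_opposite_normals[OF ext Fn closed xaF D FD below_Fn \<rho> \<delta>(1,2,4) \<eta>(1) \<open>\<eta> n < \<rho>\<close> \<eta>(2)])
        (assumption | (unfold P_def, blast))+
  qed
  then obtain c d p q \<alpha> \<beta> \<epsilon> where P: "P n (c n) (d n) (p n) (q n) (\<alpha> n) (\<beta> n) (\<epsilon> n)" for n
    by metis
  have
    \<epsilon>: "\<And>n. 0 < \<epsilon> n" "\<And>n. \<epsilon> n \<le> \<eta> n" and
    cd: "\<And>n. dist (c n) (x, a) < \<eta> n" "\<And>n. dist (d n) (x, a) < \<eta> n" and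
    unit: "\<And>n. 0 \<le> \<alpha> n" "\<And>n. (\<alpha> n)\<^sup>2 + (\<beta> n)\<^sup>2 = 1" and
    pq: "\<And>n. dist (fst (d n)) (p n) = \<delta> * \<alpha> n" "\<And>n. dist (fst (c n)) (q n) = \<delta> * \<alpha> n"
      "\<And>n. dist (p n) (q n) = 2 * \<delta> * \<alpha> n - dist (fst (c n)) (fst (d n))" and
    normal: "\<And>n w. w \<in> D \<Longrightarrow> \<delta> \<le> dist (p n, snd (d n) + \<delta> * \<beta> n) w"
      "\<And>n u s. (u, s) \<in> F n \<Longrightarrow> \<delta> \<le> dist (q n, snd (c n) - \<delta> * \<beta> n) (u, s + \<epsilon> n)"
    using P unfolding P_def by blast+
  have "\<bar>\<alpha> n\<bar> \<le> 1" "\<bar>\<beta> n\<bar> \<le> 1" for n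
    using unit(2)[of n] zero_le_power2[of "\<alpha> n"] zero_le_power2[of "\<beta> n"]
    unfolding abs_square_le_1[symmetric] by linarith+
  note \<alpha>\<beta> = this
  \<comment> \<open>By \<open>2 * \<delta> \<le> \<rho>\<close> the points \<open>p n\<close> and
    \<open>q n\<close> stay in the compact ball; including the components makes one subsequence
    serve all four sequences.\<close>
  define K where "K = cball x \<rho> \<times> cball x \<rho> \<times> {0..1::real} \<times> {-1..1::real}"
  have "compact K" unfolding K_def using \<rho>(1) by (intro compact_Times) auto
  then have "seq_compact K" by (simp add: compact_eq_seq_compact_metric)
  have "(p n, q n, \<alpha> n, \<beta> n) \<in> K" for n
  proof -
    have bound: "dist x v \<le> \<rho>" if "dist (fst u) v = \<delta> * \<alpha> n" "dist u (x, a) < \<eta> n" for u :: "'a \<times> real" and v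
    proof -
      have "dist x v \<le> dist (fst u) x + dist (fst u) v" by (rule dist_triangle3)
      also have "dist (fst u) x \<le> \<delta>" using dist_fst_le[of u "(x, a)"] that(2) \<eta>(2)[of n] by simp
      also have "dist (fst u) v \<le> \<delta>" using that(1) \<alpha>\<beta>(1)[of n] \<delta>(1) by (simp add: mult_left_le)
      finally show ?thesis using \<delta>(3) by simp
    qed
    show ?thesis
      using bound[OF pq(1) cd(2)] bound[OF pq(2) cd(1)] unit(1)[of n] \<alpha>\<beta>[of n]
      by (simp add: K_def abs_le_iff)
  qed
  then have "\<forall>n. (p n, q n, \<alpha> n, \<beta> n) \<in> K" by blast
  then obtain l r where l: "l \<in> K" and r: "strict_mono (r :: nat \<Rightarrow> nat)"
    and "((\<lambda>n. (p n, q n, \<alpha> n, \<beta> n)) \<circ> r) \<longlonglongrightarrow> l"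
    by (rule seq_compactE[OF \<open>seq_compact K\<close>]) (rule that)
  then have lim: "(\<lambda>n. (p (r n), q (r n), \<alpha> (r n), \<beta> (r n))) \<longlonglongrightarrow> l" by (simp add: o_def)
  obtain p' q' \<alpha>' \<beta>' where l': "l = (p', q', \<alpha>', \<beta>')" by (cases l)
  have lims: "(\<lambda>n. p (r n)) \<longlonglongrightarrow> p'" "(\<lambda>n. q (r n)) \<longlonglongrightarrow> q'"
    "(\<lambda>n. \<alpha> (r n)) \<longlonglongrightarrow> \<alpha>'" "(\<lambda>n. \<beta> (r n)) \<longlonglongrightarrow> \<beta>'"
    using tendsto_fst[OF lim] tendsto_fst[OF tendsto_snd[OF lim]] tendsto_fst[OF tendsto_snd[OF tendsto_snd[OF lim]]]
      tendsto_snd[OF tendsto_snd[OF tendsto_snd[OF lim]]] by (simp_all add: l')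
  have \<eta>r: "(\<lambda>n. \<eta> (r n)) \<longlonglongrightarrow> 0" using LIMSEQ_subseq_LIMSEQ[OF \<eta>0 r] by (simp add: o_def)
  have \<epsilon>r: "(\<lambda>n. \<epsilon> (r n)) \<longlonglongrightarrow> 0"
    by (rule tendsto_sandwich[OF _ _ tendsto_const \<eta>r]) (simp_all add: \<epsilon> less_imp_le)
  have to_xa: "(\<lambda>n. u (r n)) \<longlonglongrightarrow> (x, a)" if "\<And>n. dist (u n) (x, a) < \<eta> n" for u
  proof -
    have "(\<lambda>n. dist (u (r n)) (x, a)) \<longlonglongrightarrow> 0"
      by (rule tendsto_sandwich[OF _ _ tendsto_const \<eta>r]) (simp_all add: that less_imp_le)
    then show ?thesis by (simp add: tendsto_dist_iff[of _ "(x, a)"])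
  qed
  have c: "(\<lambda>n. fst (c (r n))) \<longlonglongrightarrow> x" "(\<lambda>n. snd (c (r n))) \<longlonglongrightarrow> a"
    and d: "(\<lambda>n. fst (d (r n))) \<longlonglongrightarrow> x" "(\<lambda>n. snd (d (r n))) \<longlonglongrightarrow> a"
    using tendsto_fst[OF to_xa[OF cd(1)]] tendsto_snd[OF to_xa[OF cd(1)]]
      tendsto_fst[OF to_xa[OF cd(2)]] tendsto_snd[OF to_xa[OF cd(2)]] by simp_all
  show thesis
  proof (rule that[of \<alpha>' \<beta>' p' q'])
    show "0 \<le> \<alpha>'" using l by (simp add: l' K_def)
    have "(\<lambda>n. (\<alpha> (r n))\<^sup>2 + (\<beta> (r n))\<^sup>2) \<longlonglongrightarrow> \<alpha>'\<^sup>2 + \<beta>'\<^sup>2" by (intro tendsto_intros lims)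
    then show "\<alpha>'\<^sup>2 + \<beta>'\<^sup>2 = 1" by (simp add: unit LIMSEQ_const_iff)
    have "(\<lambda>n. dist (fst (d (r n))) (p (r n))) \<longlonglongrightarrow> dist x p'" by (intro tendsto_intros lims d)
    moreover have "(\<lambda>n. dist (fst (d (r n))) (p (r n))) \<longlonglongrightarrow> \<delta> * \<alpha>'"
      unfolding pq by (intro tendsto_intros lims)
    ultimately show "dist x p' = \<delta> * \<alpha>'" by (rule LIMSEQ_unique)
    have "(\<lambda>n. dist (fst (c (r n))) (q (r n))) \<longlonglongrightarrow> dist x q'" by (intro tendsto_intros lims c)
    moreover have "(\<lambda>n. dist (fst (c (r n))) (q (r n))) \<longlonglongrightarrow> \<delta> * \<alpha>'"
      unfolding pq by (intro tendsto_intros lims)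
    ultimately show "dist x q' = \<delta> * \<alpha>'" by (rule LIMSEQ_unique)
    have "(\<lambda>n. dist (p (r n)) (q (r n))) \<longlonglongrightarrow> dist p' q'" by (intro tendsto_intros lims)
    moreover have "(\<lambda>n. dist (p (r n)) (q (r n))) \<longlonglongrightarrow> 2 * \<delta> * \<alpha>' - dist x x"
      unfolding pq by (intro tendsto_intros lims c d)
    ultimately show "dist p' q' = 2 * \<delta> * \<alpha>'" using LIMSEQ_unique by fastforce
    show "\<delta> \<le> dist (p', a + \<delta> * \<beta>') w" if "w \<in> D" for w
    proof (rule LIMSEQ_le_const)
      show "(\<lambda>n. dist (p (r n), snd (d (r n)) + \<delta> * \<beta> (r n)) w) \<longlonglongrightarrow> dist (p', a + \<delta> * \<beta>') w"
        by (intro tendsto_intros lims d)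
    qed (use normal(1)[OF that] in blast)
    show "\<delta> \<le> dist (q', a - \<delta> * \<beta>') w" if "w \<in> E" for w
    proof (rule LIMSEQ_le_const)
      \<comment> \<open>The inequality for \<open>w\<close> is the limit of those for its lifts into
        \<open>F (r n)\<close>.\<close>
      have \<psi>0: "(\<lambda>n. \<psi> (fst w) / Suc (r n)) \<longlonglongrightarrow> 0"
        using LIMSEQ_subseq_LIMSEQ[OF lim_const_over_n[THEN LIMSEQ_Suc] r] by (simp add: o_def)
      have "(\<lambda>n. dist (q (r n), snd (c (r n)) - \<delta> * \<beta> (r n))
            (fst w, snd w + \<psi> (fst w) / Suc (r n) + \<epsilon> (r n)))
          \<longlonglongrightarrow> dist (q', a - \<delta> * \<beta>') (fst w, snd w + 0 + 0)"
        by (intro tendsto_intros lims c \<psi>0 \<epsilon>r)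
      then show "(\<lambda>n. dist (q (r n), snd (c (r n)) - \<delta> * \<beta> (r n))
            (fst w, snd w + \<psi> (fst w) / Suc (r n) + \<epsilon> (r n))) \<longlonglongrightarrow> dist (q', a - \<delta> * \<beta>') w"
        by simp
      show "\<exists>N. \<forall>n\<ge>N. \<delta> \<le> dist (q (r n), snd (c (r n)) - \<delta> * \<beta> (r n))
            (fst w, snd w + \<psi> (fst w) / Suc (r n) + \<epsilon> (r n))"
        using that by (intro exI[of _ 0] allI impI normal(2)) (simp add: F_def)
    qed
  qed
qed

end

section \<open>The sum rule at a minimum point\<close>

theorem theorem4p20:
  fixes \<kappa> :: real
    and R :: "'a::metric_space \<Rightarrow> real"
    and f g :: "'a \<Rightarrow> ereal"
    and x :: 'a
  assumes "0 < \<kappa>"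
    and "locally compact (UNIV :: 'a set)"
    and "uniquely_geodesic TYPE('a)"
    and "CAT \<kappa> TYPE('a)"
    and "bounded (UNIV :: 'a set)"
    and "diameter (UNIV :: 'a set) < pi / (2 * sqrt \<kappa>)"
    and "\<And>p. geodesic_extension_around p (R p)"
    and "\<And>p. R p < pi / (2 * sqrt \<kappa>)"
    and "\<And>y. - \<infinity> < f y" and "\<And>y. - \<infinity> < g y"
    and "geodesically_convex f" and "geodesically_convex g"
    and "complete_sublevel_sets f" and "complete_sublevel_sets g"
    and "x \<in> eff_dom f \<inter> eff_dom g"
    and "\<And>y. f x + g x \<le> f y + g y"
    and "continuous (at x) f"
  shows "\<exists>u \<in> subdifferential (R x) f x. \<exists>v \<in> subdifferential (R x) g x. opposite u v"
proof -
  note ext = \<open>\<And>p. geodesic_extension_around p (R p)\<close>[of x]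
  have R: "0 < R x" using ext by (simp add: geodesic_extension_around_def)
  interpret small_CAT \<kappa> "TYPE('a)"
  proof
    show "dist y z < pi / (2 * sqrt \<kappa>)" for y z :: 'a
      using diameter_bounded_bound[OF \<open>bounded UNIV\<close>, of y z] assms(6) by simp
  qed fact+
  obtain a where a: "f x = ereal a"
    using assms(9)[of x] assms(15) by (cases "f x") (auto simp: eff_dom_def)
  obtain b where b: "g x = ereal b"
    using assms(10)[of x] assms(15) by (cases "g x") (auto simp: eff_dom_def)

  obtain U V where UV: "open U" "compact V" "x \<in> U" "U \<subseteq> V"
    using assms(2)[unfolded locally_def, rule_format, of UNIV x] by auto
  then obtain e where e: "0 < e" "cball x e \<subseteq> U" using open_contains_cball by blast
  define \<rho> where "\<rho> = min e 1"
  have "compact (V \<inter> cball x \<rho>)" using UV by (intro compact_Int_closed) auto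
  moreover have "V \<inter> cball x \<rho> = cball x \<rho>" using e UV by (force simp: \<rho>_def)
  ultimately have \<rho>: "0 < \<rho>" "\<rho> \<le> 1" "compact (cball x \<rho>)" using e by (auto simp: \<rho>_def)

  \<comment> \<open>Half of \<open>\<rho>\<close> keeps the prolonged points in the compact ball,
    \<open>R x / 4\<close> permits extension on both sides, and \<open>pi / 4\<close> after scaling
    is the range of the strict cosine rule.\<close>
  define \<delta> where "\<delta> = min (min (\<rho> / 2) (R x / 4)) (pi / 4 / sqrt \<kappa>)"
  have \<delta>: "0 < \<delta>" "\<delta> \<le> R x / 4" "2 * \<delta> \<le> \<rho>" using R \<rho> \<kappa> by (auto simp: \<delta>_def)
  have "sqrt \<kappa> * \<delta> \<le> sqrt \<kappa> * (pi / 4 / sqrt \<kappa>)"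
    using \<kappa> by (intro mult_left_mono) (auto simp: \<delta>_def)
  then have \<delta>k: "sqrt \<kappa> * \<delta> \<le> pi / 4" using \<kappa> by simp

  text \<open>The reflection of \<open>epi g\<close> that touches \<open>epi f\<close> from below at \<open>(x, f x)\<close>.\<close>
  define D where "D = {v. (fst v, a + b - snd v) \<in> epi g}"
  have D_iff: "(u, t) \<in> D \<longleftrightarrow> g u \<le> ereal (a + b - t)" for u t by (simp add: D_def epi_iff)
  have D: "product_convex D" "closed D" "(x, a) \<in> D"
  proof -
    show "product_convex D"
      unfolding product_convex_def
    proof (intro allI impI ballI; elim conjE)
      fix c :: "real \<Rightarrow> 'a" and r s t :: real
      assume c: "affine_geodesic c" and rs: "(c 0, r) \<in> D" "(c 1, s) \<in> D" and t: "t \<in> {0..1}"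
      have "(c t, (a + b - r) + t * ((a + b - s) - (a + b - r))) \<in> epi g"
        using rs t by (intro product_convexD[OF product_convex_epi[OF assms(12)] c]) (auto simp: D_def)
      then show "(c t, r + t * (s - r)) \<in> D" by (simp add: D_def algebra_simps)
    qed
    have "D = (\<lambda>v. (fst v, a + b - snd v)) -` epi g" by (auto simp: D_def)
    then show "closed D"
      using closed_epi[OF assms(14)] by (auto intro!: closed_vimage continuous_intros)
    show "(x, a) \<in> D" by (simp add: D_iff b)
  qed
  have below: "t \<le> s" if "(u, s) \<in> epi f" "(u, t) \<in> D" for u s t
  proof -
    have "ereal (a + b) \<le> f u + g u" using assms(16)[of u] by (simp add: a b)
    also have "\<dots> \<le> ereal s + ereal (a + b - t)" using that by (intro add_mono) (auto simp: epi_iff D_iff)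
    finally show ?thesis by simp
  qed
  have contact: "s = a" if "(x, s) \<in> epi f" "(x, s) \<in> D" for s
    using that by (simp add: epi_iff D_iff a b)
  have upward: "(u, t) \<in> epi f" if "(u, s) \<in> epi f" "s \<le> t" for u s t
    using that by (auto simp: epi_iff intro: order_trans)
  have xa: "(x, a) \<in> epi f" by (simp add: epi_iff a)
  obtain p q \<alpha> \<beta> where unit: "0 \<le> \<alpha>" "\<alpha>\<^sup>2 + \<beta>\<^sup>2 = 1"
    and pq: "dist x p = \<delta> * \<alpha>" "dist x q = \<delta> * \<alpha>" "dist p q = 2 * \<delta> * \<alpha>"
    and normal_D: "\<And>w. w \<in> D \<Longrightarrow> \<delta> \<le> dist (p, a + \<delta> * \<beta>) w"
    and normal_f: "\<And>w. w \<in> epi f \<Longrightarrow> \<delta> \<le> dist (q, a - \<delta> * \<beta>) w"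
    by (rule opposite_normals_at_contact[OF ext product_convex_epi[OF assms(11)] closed_epi[OF assms(13)] xa
          upward D below contact \<rho>(3,2) \<delta> \<delta>k]) (assumption | blast)+

  obtain \<theta> where \<theta>: "0 < \<theta>" "\<And>u. dist x u < \<theta> \<Longrightarrow> (u, a + 1) \<in> epi f"
  proof -
    have "eventually (\<lambda>u. f u < ereal (a + 1)) (at x)"
      using assms(17) by (intro order_tendstoD(2)[where y = "f x"]) (auto simp: continuous_at a)
    then obtain \<theta> where "0 < \<theta>" "\<And>u. u \<noteq> x \<Longrightarrow> dist u x < \<theta> \<Longrightarrow> f u < ereal (a + 1)"
      by (auto simp: eventually_at)
    \<comment> \<open>The filter \<open>at x\<close> omits \<open>x\<close> itself, where the bound
      is immediate.\<close>
    moreover from this have "f u \<le> ereal (a + 1)" if "dist x u < \<theta>" for u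
      using that by (cases "u = x") (auto simp: a dist_commute less_imp_le)
    ultimately show thesis by (intro that[of \<theta>]) (auto simp: epi_iff)
  qed
  have "0 < \<beta>"
    by (rule normal_not_horizontal[OF product_convex_epi[OF assms(11)] xa \<theta> \<delta>(1) unit pq(2) normal_f])
  \<comment> \<open>The reflection of heights \<open>t\<close> to \<open>a + b - t\<close> is an
    isometry that carries \<open>D\<close> to \<open>epi g\<close>, and the upward normal of
    \<open>D\<close> to a downward normal of \<open>epi g\<close> with the same components.\<close>
  have normal_g: "\<delta> \<le> dist (p, b - \<delta> * \<beta>) w" if "w \<in> epi g" for w
  proof -
    have "\<delta> \<le> dist (p, a + \<delta> * \<beta>) (fst w, a + b - snd w)"
      using that by (intro normal_D) (simp add: D_def)
    also have "\<dots> = dist (p, b - \<delta> * \<beta>) w"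
    proof (rule power2_eq_imp_eq)
      show "(dist (p, a + \<delta> * \<beta>) (fst w, a + b - snd w))\<^sup>2 = (dist (p, b - \<delta> * \<beta>) w)\<^sup>2"
        by (cases w) (simp add: dist_Pair_power2, simp add: power2_eq_square algebra_simps)
    qed auto
    finally show ?thesis .
  qed
  have \<delta>R: "\<delta> < R x" using \<delta> R by simp
  \<comment> \<open>Both vectors receive the length \<open>\<alpha> / \<beta>\<close>, because the
    two normals share their components; their geodesics pass through \<open>q\<close> and
    \<open>p\<close>.\<close>
  obtain l \<gamma> where \<gamma>: "tangent_vector x l \<gamma> (\<alpha> / \<beta>) \<in> subdifferential (R x) f x"
    "0 < \<alpha> \<Longrightarrow> (l, \<gamma>) \<in> geodesics_from x" "0 < \<alpha> \<Longrightarrow> \<delta> * \<alpha> \<le> l" "0 < \<alpha> \<Longrightarrow> \<gamma> (\<delta> * \<alpha>) = q"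
    by (rule tangent_vector_mem_subdifferential[OF assms(11) a ext \<delta>(1) \<delta>R \<delta>k unit(1) \<open>0 < \<beta>\<close> unit(2) pq(2) normal_f]) blast+
  obtain m \<eta> where \<eta>: "tangent_vector x m \<eta> (\<alpha> / \<beta>) \<in> subdifferential (R x) g x"
    "0 < \<alpha> \<Longrightarrow> (m, \<eta>) \<in> geodesics_from x" "0 < \<alpha> \<Longrightarrow> \<delta> * \<alpha> \<le> m" "0 < \<alpha> \<Longrightarrow> \<eta> (\<delta> * \<alpha>) = p"
    by (rule tangent_vector_mem_subdifferential[OF assms(12) b ext \<delta>(1) \<delta>R \<delta>k unit(1) \<open>0 < \<beta>\<close> unit(2) pq(1) normal_g]) blast+
  have "opposite (tangent_vector x l \<gamma> (\<alpha> / \<beta>)) (tangent_vector x m \<eta> (\<alpha> / \<beta>))"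
  proof (cases "\<alpha> = 0")
    case True
    then show ?thesis by (simp add: opposite_def tangent_vector_def cone_point_def)
  next
    case False
    then have "0 < \<alpha>" using unit by simp
    have "alexandrov_angle \<gamma> \<eta> = pi"
      using \<gamma>(2-4)[OF \<open>0 < \<alpha>\<close>] \<eta>(2-4)[OF \<open>0 < \<alpha>\<close>] \<open>0 < \<alpha>\<close> \<delta>(1) pq(3)
      by (intro alexandrov_angle_eq_pi[of l \<gamma> m \<eta> "\<delta> * \<alpha>"]) (auto simp: geodesics_from_def dist_commute)
    then have "\<exists>(l', \<gamma>')\<in>same_direction x `` {(l, \<gamma>)}. \<exists>(m', \<eta>')\<in>same_direction x `` {(m, \<eta>)}.
        alexandrov_angle \<gamma>' \<eta>' = pi"
      using same_direction_refl[OF \<gamma>(2)[OF \<open>0 < \<alpha>\<close>]] same_direction_refl[OF \<eta>(2)[OF \<open>0 < \<alpha>\<close>]] by blast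
    then show ?thesis
      using \<open>0 < \<alpha>\<close> \<open>0 < \<beta>\<close> by (simp add: opposite_def tangent_vector_def cone_point_def)
  qed
  with \<gamma>(1) \<eta>(1) show ?thesis by blast
qed

end
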